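(* Let $m\ge2$, let $H$ be a complex Hilbert space, and let $E$ be a POVM on $\Omega_m=\{0,\dots,m-1\}^{\mathbb N}$ with values in $B(H)$. There is a one-to-one correspondence between strictly positive normalized range martingales $X=\{X_w\}_w$ for $E$, and POVMs $F$ on $\Omega_m$ with values in $B(H)$ such that $aE\le F\le bE$ for some $0<a\le b<\infty$. The correspondence is given on cylinders by $$F([w])=E_w^{1/2}X_wE_w^{1/2}$$ for every finite word $w$.
   Context: $\Omega_m$ carries its product Borel $\sigma$-algebra $\mathcal B(\Omega_m)$. For a finite word $w=w_1\cdots w_n$ in $\{0,\dots,m-1\}$, $[w]=\{x\in\Omega_m:x_1=w_1,\dots,x_n=w_n\}$; the empty word is $\varnothing$, and $[\varnothing]=\Omega_m$; $wj$ is $w$ with the letter $j$ appended. A POVM on $\Omega_m$ with values in $B(H)$ is a map $E:\mathcal B(\Omega_m)\to B(H)_+$ that is countably additive in the weak operator topology and satisfies $E(\Omega_m)=I$. Inequalities between operator-valued measures are meant setwise on Borel sets. Put $E_w=E([w])$ and $H_w=\overline{\operatorname{ran}}(E_w^{1/2})$; operators on $H_w$ are extended by zero on $H_w^\perp$ in products with $E_w^{1/2}$. For $0\le j\le m-1$, the edge contraction $C_{wj}:H_w\to H_{wj}$ is the unique contraction with $C_{wj}E_w^{1/2}h=E_{wj}^{1/2}h$ for all $h\in H$. A bounded range martingale for $E$ is a family of self-adjoint operators $X_w\in B(H_w)$, indexed by all finite words $w$, such that $\sup_w\|X_w\|<\infty$ and $X_w=\sum_{j=0}^{m-1}C_{wj}^*X_{wj}C_{wj}$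 for every $w$; it is positive if all $X_w\ge0$. A positive range martingale is strictly positive if there are constants $0<a\le b<\infty$ with $aI_{H_w}\le X_w\le bI_{H_w}$ for every $w$, and normalized if $X_\varnothing=I_H$. *)

theory Defs
  imports "HOL-Analysis.Analysis"
begin

text \<open>
  Complex inner product spaces, with the inner product linear in the second argument. They extend
  \<^class>\<open>real_inner\<close>: the real inner product is the real part of the complex one, so the
  norm is \<open>sqrt (Re (cinner x x))\<close> and definiteness is inherited.
\<close>

class complex_inner = real_inner +
  fixes scaleC :: "complex \<Rightarrow> 'a \<Rightarrow> 'a"  (infixr "*\<^sub>C" 75)
    and cinner :: "'a \<Rightarrow> 'a \<Rightarrow> complex"
  assumes scaleC_add_right: "c *\<^sub>C (x + y) = c *\<^sub>C x + c *\<^sub>C y"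
    and scaleC_add_left: "(c + d) *\<^sub>C x = c *\<^sub>C x + d *\<^sub>C x"
    and scaleC_scaleC: "c *\<^sub>C d *\<^sub>C x = (c * d) *\<^sub>C x"
    and scaleC_of_real: "complex_of_real r *\<^sub>C x = r *\<^sub>R x"
    and cinner_commute: "cinner x y = cnj (cinner y x)"
    and cinner_add_right: "cinner x (y + z) = cinner x y + cinner x z"
    and cinner_scaleC_right: "cinner x (c *\<^sub>C y) = c * cinner x y"
    and inner_eq_Re_cinner: "inner x y = Re (cinner x y)"

class complex_hilbert = complex_inner + complete_space

instantiation complex :: complex_hilbert
begin

definition scaleC_complex :: "complex \<Rightarrow> complex \<Rightarrow> complex" where
  "scaleC_complex c x = c * x"

definition cinner_complex :: "complex \<Rightarrow> complex \<Rightarrow> complex" where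
  "cinner_complex x y = cnj x * y"

instance
  by standard
    (auto simp: scaleC_complex_def cinner_complex_def algebra_simps inner_complex_def scaleR_conv_of_real)

end

definition bounded_clinear :: "('a::complex_inner \<Rightarrow> 'a) \<Rightarrow> bool" where
  "bounded_clinear T \<longleftrightarrow> bounded_linear T \<and> (\<forall>c x. T (c *\<^sub>C x) = c *\<^sub>C T x)"

definition orth_compl :: "'a::complex_inner set \<Rightarrow> 'a set" where
  "orth_compl K = {x. \<forall>y\<in>K. cinner y x = 0}"

text \<open>
  For closed subspaces \<open>K\<close> and \<open>L\<close>, an operator in \<open>B(K, L)\<close> is represented by its extension
  by zero on the orthogonal complement of \<open>K\<close>.
\<close>

definition bops :: "'a::complex_inner set \<Rightarrow> 'a set \<Rightarrow> ('a \<Rightarrow> 'a) set" where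
  "bops K L = {T. bounded_clinear T \<and> range T \<subseteq> L \<and> (\<forall>x\<in>orth_compl K. T x = 0)}"

definition selfadjoint :: "('a::complex_inner \<Rightarrow> 'a) \<Rightarrow> bool" where
  "selfadjoint T \<longleftrightarrow> (\<forall>x y. cinner (T x) y = cinner x (T y))"

definition op_le_on :: "'a::complex_inner set \<Rightarrow> ('a \<Rightarrow> 'a) \<Rightarrow> ('a \<Rightarrow> 'a) \<Rightarrow> bool" where
  "op_le_on K S T \<longleftrightarrow> (\<forall>h\<in>K. cinner h (T h - S h) \<in> \<real>\<^sub>\<ge>\<^sub>0)"

abbreviation op_le :: "('a::complex_inner \<Rightarrow> 'a) \<Rightarrow> ('a \<Rightarrow> 'a) \<Rightarrow> bool" where
  "op_le \<equiv> op_le_on UNIV"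

definition positive_op :: "('a::complex_inner \<Rightarrow> 'a) \<Rightarrow> bool" where
  "positive_op T \<longleftrightarrow> bounded_clinear T \<and> op_le (\<lambda>h. 0) T"

definition op_sqrt :: "('a::complex_inner \<Rightarrow> 'a) \<Rightarrow> 'a \<Rightarrow> 'a" where
  "op_sqrt T = (THE S. positive_op S \<and> S \<circ> S = T)"

text \<open>
  The adjoint of the extension by zero of an operator in \<open>B(K, L)\<close> is the extension by zero of its
  adjoint in \<open>B(L, K)\<close>.
\<close>

definition cadjoint :: "('a::complex_inner \<Rightarrow> 'a) \<Rightarrow> 'a \<Rightarrow> 'a" where
  "cadjoint T = (THE S. \<forall>x y. cinner (S x) y = cinner x (T y))"

text \<open>Sequences are indexed from 0, so the letter \<open>x\<^sub>i\<close> of a point is \<open>x (i - 1)\<close>. The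
  product sigma-algebra of the discrete factors is the product Borel sigma-algebra.\<close>

definition Omega :: "nat \<Rightarrow> (nat \<Rightarrow> nat) measure" where
  "Omega m = PiM UNIV (\<lambda>_. count_space {..<m})"

abbreviation words :: "nat \<Rightarrow> nat list set" where
  "words m \<equiv> lists {..<m}"

definition cylinder :: "nat \<Rightarrow> nat list \<Rightarrow> (nat \<Rightarrow> nat) set" where
  "cylinder m w = {x \<in> space (Omega m). \<forall>i<length w. x i = w ! i}"

text \<open>The values of a POVM outside the sigma-algebra are left unconstrained here.\<close>

definition povm :: "nat \<Rightarrow> ((nat \<Rightarrow> nat) set \<Rightarrow> 'a::complex_inner \<Rightarrow> 'a) \<Rightarrow> bool" where
  "povm m E \<longleftrightarrow>
     (\<forall>A\<in>sets (Omega m). positive_op (E A)) \<and>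
     (\<forall>A. range A \<subseteq> sets (Omega m) \<longrightarrow> disjoint_family A \<longrightarrow>
        (\<forall>h k. (\<lambda>n::nat. cinner h (E (A n) k)) sums cinner h (E (\<Union>n. A n) k))) \<and>
     E (space (Omega m)) = id"

definition comparable_povm ::
  "nat \<Rightarrow> ((nat \<Rightarrow> nat) set \<Rightarrow> 'a::complex_inner \<Rightarrow> 'a) \<Rightarrow> ((nat \<Rightarrow> nat) set \<Rightarrow> 'a \<Rightarrow> 'a) \<Rightarrow> bool" where
  "comparable_povm m E F \<longleftrightarrow>
     (\<exists>a b::real. 0 < a \<and> a \<le> b \<and>
        (\<forall>A\<in>sets (Omega m).
           op_le (\<lambda>h. a *\<^sub>R E A h) (F A) \<and> op_le (F A) (\<lambda>h. b *\<^sub>R E A h)))"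

definition sqrtE ::
  "nat \<Rightarrow> ((nat \<Rightarrow> nat) set \<Rightarrow> 'a::complex_inner \<Rightarrow> 'a) \<Rightarrow> nat list \<Rightarrow> 'a \<Rightarrow> 'a" where
  "sqrtE m E w = op_sqrt (E (cylinder m w))"

definition range_space ::
  "nat \<Rightarrow> ((nat \<Rightarrow> nat) set \<Rightarrow> 'a::complex_inner \<Rightarrow> 'a) \<Rightarrow> nat list \<Rightarrow> 'a set" where
  "range_space m E w = closure (range (sqrtE m E w))"

definition edge_contraction ::
  "nat \<Rightarrow> ((nat \<Rightarrow> nat) set \<Rightarrow> 'a::complex_inner \<Rightarrow> 'a) \<Rightarrow> nat list \<Rightarrow> nat \<Rightarrow> 'a \<Rightarrow> 'a" where
  "edge_contraction m E w j =
     (THE C. C \<in> bops (range_space m E w) (range_space m E (w @ [j])) \<and> onorm C \<le> 1 \<and>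
        (\<forall>h. C (sqrtE m E w h) = sqrtE m E (w @ [j]) h))"

text \<open>
  The operators are taken as zero-extended elements of \<open>B(H\<^sub>w)\<close>, which changes neither their norm
  nor their self-adjointness. Values at lists that are not words over \<open>{..<m}\<close> are unconstrained.
\<close>

definition bounded_range_martingale ::
  "nat \<Rightarrow> ((nat \<Rightarrow> nat) set \<Rightarrow> 'a::complex_inner \<Rightarrow> 'a) \<Rightarrow> (nat list \<Rightarrow> 'a \<Rightarrow> 'a) \<Rightarrow> bool" where
  "bounded_range_martingale m E X \<longleftrightarrow>
     (\<forall>w\<in>words m. X w \<in> bops (range_space m E w) (range_space m E w) \<and> selfadjoint (X w)) \<and>
     bdd_above ((\<lambda>w. onorm (X w)) ` words m) \<and>
     (\<forall>w\<in>words m. X w = (\<lambda>h. \<Sum>j<m.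
        cadjoint (edge_contraction m E w j) (X (w @ [j]) (edge_contraction m E w j h))))"

definition positive_range_martingale ::
  "nat \<Rightarrow> ((nat \<Rightarrow> nat) set \<Rightarrow> 'a::complex_inner \<Rightarrow> 'a) \<Rightarrow> (nat list \<Rightarrow> 'a \<Rightarrow> 'a) \<Rightarrow> bool" where
  "positive_range_martingale m E X \<longleftrightarrow>
     bounded_range_martingale m E X \<and>
     (\<forall>w\<in>words m. op_le_on (range_space m E w) (\<lambda>h. 0) (X w))"

definition strictly_positive_range_martingale ::
  "nat \<Rightarrow> ((nat \<Rightarrow> nat) set \<Rightarrow> 'a::complex_inner \<Rightarrow> 'a) \<Rightarrow> (nat list \<Rightarrow> 'a \<Rightarrow> 'a) \<Rightarrow> bool" where
  "strictly_positive_range_martingale m E X \<longleftrightarrow>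
     positive_range_martingale m E X \<and>
     (\<exists>a b::real. 0 < a \<and> a \<le> b \<and>
        (\<forall>w\<in>words m.
           op_le_on (range_space m E w) (\<lambda>h. a *\<^sub>R h) (X w) \<and>
           op_le_on (range_space m E w) (X w) (\<lambda>h. b *\<^sub>R h)))"

definition normalized_martingale :: "(nat list \<Rightarrow> 'a \<Rightarrow> 'a) \<Rightarrow> bool" where
  "normalized_martingale X \<longleftrightarrow> X [] = id"

text \<open>
  The two sides of the correspondence, as sets of functions on words and on the sigma-algebra. Since
  HOL functions are total, extensionality fixes the irrelevant values outside these domains.
\<close>

definition martingale_set ::
  "nat \<Rightarrow> ((nat \<Rightarrow> nat) set \<Rightarrow> 'a::complex_inner \<Rightarrow> 'a) \<Rightarrow> (nat list \<Rightarrow> 'a \<Rightarrow> 'a) set" where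
  "martingale_set m E =
     {X \<in> extensional (words m). strictly_positive_range_martingale m E X \<and> normalized_martingale X}"

definition comparable_povm_set ::
  "nat \<Rightarrow> ((nat \<Rightarrow> nat) set \<Rightarrow> 'a::complex_inner \<Rightarrow> 'a) \<Rightarrow> ((nat \<Rightarrow> nat) set \<Rightarrow> 'a \<Rightarrow> 'a) set" where
  "comparable_povm_set m E =
     {F \<in> extensional (sets (Omega m)). povm m F \<and> comparable_povm m E F}"

end

theory Submission
  imports Defs
begin

text \<open>
  The two sides are linked by the relation \<open>F [w] = E\<^sub>w\<^sup>1\<^sup>/\<^sup>2 X\<^sub>w E\<^sub>w\<^sup>1\<^sup>/\<^sup>2\<close> for all words \<open>w\<close>, and the theorem says
  that this relation is the graph of a bijection. It determines \<open>X\<close>, because an operator on the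
  closure \<open>H\<^sub>w\<close> of the range of the positive operator \<open>S = E\<^sub>w\<^sup>1\<^sup>/\<^sup>2\<close> is recovered from \<open>S X S\<close>
  (lemma \<open>sandwich_inj\<close>), and it determines \<open>F\<close>, because cylinders form an intersection-stable
  generator of the sigma-algebra (lemma \<open>povm_eqI\<close>).

  From \<open>F\<close> to \<open>X\<close>: since \<open>F [w] \<le> b E\<^sub>w\<close>, Douglas factorisation writes the root of \<open>F [w]\<close> as
  \<open>D E\<^sub>w\<^sup>1\<^sup>/\<^sup>2\<close>, and \<open>X\<^sub>w = D\<^sup>* D\<close> (lemma \<open>sandwich_exists\<close>). As \<open>E\<^sub>w\<^sup>1\<^sup>/\<^sup>2 C\<^sup>*\<close> is the root of
  \<open>E\<^sub>w\<^sub>j\<close> for an edge contraction \<open>C\<close>, both sides of the martingale relation give the same operator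
  when placed between roots of \<open>E\<^sub>w\<close>: the relation is the additivity of \<open>F\<close> under splitting \<open>[w]\<close>
  into the cylinders \<open>[wj]\<close>. The two operator bounds pass from the range of the root to its closure
  by continuity.

  From \<open>X\<close> to \<open>F\<close>: for every vector \<open>h\<close>, the number \<open>\<langle>h, E\<^sub>w\<^sup>1\<^sup>/\<^sup>2 X\<^sub>w E\<^sub>w\<^sup>1\<^sup>/\<^sup>2 h\<rangle>\<close> is an additive function
  of cylinders dominated by the finite measure \<open>b \<langle>h, E(-) h\<rangle>\<close>. The domination gives continuity at
  the empty set, and hence an extension to a measure by Caratheodory's theorem
  (lemma \<open>dominated_cylinder_extension\<close>). The complex measures obtained from these by polarization
  are sesquilinear in the vectors, since they are so on cylinders, and bounded, so they are the matrix
  entries of operators \<open>F A\<close> (lemma \<open>povm_extension\<close>). The inequalities between \<open>E\<close> and \<open>F\<close>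
  extend from cylinders to Borel sets because the difference of the two measures is itself such an
  extension (lemma \<open>measure_le_of_cylinders\<close>).

  The operator theory used on the way rests on one minimisation argument: a bounded functional on a
  subspace is represented by a vector of its closure (lemma \<open>riesz_real\<close>). This yields adjoints,
  orthogonal projections and Douglas factorisation. Positive square roots are limits in norm of a
  quadratic iteration (lemmas \<open>positive_op_sqrt_exists\<close> and \<open>op_sqrt_eqI\<close>).
\<close>

section \<open>Complex inner product spaces\<close>

instance complex_hilbert \<subseteq> banach ..

lemma scaleC_one [simp]: "1 *\<^sub>C x = (x::'a::complex_inner)"
  using scaleC_of_real[of 1 x] by simp

lemma scaleC_zero [simp]: "0 *\<^sub>C x = (0::'a::complex_inner)"
  using scaleC_of_real[of 0 x] by simp

lemma scaleC_zero_right [simp]: "c *\<^sub>C (0::'a::complex_inner) = 0"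
  using scaleC_add_right[of c "0::'a" 0] by simp

lemma scaleR_eq_scaleC: "r *\<^sub>R x = complex_of_real r *\<^sub>C (x::'a::complex_inner)"
  by (simp add: scaleC_of_real)

lemma cinner_add_left: "cinner (x + y) z = cinner x z + cinner y (z::'a::complex_inner)"
  by (metis cinner_add_right cinner_commute complex_cnj_add)

lemma cinner_scaleC_left: "cinner (c *\<^sub>C x) y = cnj c * cinner x (y::'a::complex_inner)"
  by (metis cinner_scaleC_right cinner_commute complex_cnj_mult)

lemma cinner_scaleR_right: "cinner x (r *\<^sub>R y) = r *\<^sub>R cinner x (y::'a::complex_inner)"
  by (metis scaleR_eq_scaleC cinner_scaleC_right scaleR_conv_of_real)

lemma cinner_scaleR_left: "cinner (r *\<^sub>R x) y = r *\<^sub>R cinner x (y::'a::complex_inner)"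
  by (metis scaleR_eq_scaleC cinner_scaleC_left scaleR_conv_of_real complex_cnj_complex_of_real)

lemma cinner_self: "cinner x x = complex_of_real ((norm x)\<^sup>2)" for x :: "'a::complex_inner"
proof (rule complex_eqI)
  show "Re (cinner x x) = Re (complex_of_real ((norm x)\<^sup>2))"
    by (simp add: power2_norm_eq_inner inner_eq_Re_cinner)
  show "Im (cinner x x) = Im (complex_of_real ((norm x)\<^sup>2))"
    using arg_cong[OF cinner_commute[of x x], of Im] by simp
qed

lemma norm_cinner_self: "norm (cinner x x) = (norm x)\<^sup>2" for x :: "'a::complex_inner"
  by (simp only: cinner_self norm_of_real abs_power2)

lemma Re_cinner_self: "Re (cinner x x) = (norm x)\<^sup>2" for x :: "'a::complex_inner"
  by (simp only: cinner_self Re_complex_of_real)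

lemma norm_scaleC: "norm (c *\<^sub>C x) = norm c * norm x" for x :: "'a::complex_inner"
proof -
  have "cinner (c *\<^sub>C x) (c *\<^sub>C x) = (c * cnj c) * cinner x x"
    by (simp add: cinner_scaleC_left cinner_scaleC_right)
  also have "c * cnj c = complex_of_real ((norm c)\<^sup>2)"
    by (simp only: complex_norm_square)
  finally have "norm (cinner (c *\<^sub>C x) (c *\<^sub>C x)) = norm (complex_of_real ((norm c)\<^sup>2) * cinner x x)"
    by simp
  then have "(norm (c *\<^sub>C x))\<^sup>2 = (norm c * norm x)\<^sup>2"
    by (simp only: norm_cinner_self norm_mult norm_of_real abs_power2 power_mult_distrib)
  then show ?thesis
    by (rule power2_eq_imp_eq) auto
qed

lemma cinner_norm_le: "norm (cinner x y) \<le> norm x * norm y" for x y :: "'a::complex_inner"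
proof (cases "cinner x y = 0")
  case False
  \<comment> \<open>Rotating \<open>y\<close> makes the complex inner product real, hence equal to the real one.\<close>
  define c where "c = cnj (cinner x y) / norm (cinner x y)"
  have c: "norm c = 1"
    using False by (simp add: c_def norm_divide)
  have "c * cinner x y = norm (cinner x y)"
    using False complex_norm_square[of "cinner x y"]
    by (simp add: c_def field_simps power2_eq_square)
  then have "norm (cinner x y) = inner x (c *\<^sub>C y)"
    by (simp add: inner_eq_Re_cinner cinner_scaleC_right)
  also have "\<dots> \<le> norm x * norm (c *\<^sub>C y)"
    by (rule norm_cauchy_schwarz)
  finally show ?thesis
    by (simp add: norm_scaleC c)
qed simp

lemma bounded_bilinear_cinner:
  "bounded_bilinear (cinner :: 'a::complex_inner \<Rightarrow> 'a \<Rightarrow> complex)"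
proof
  show "\<exists>K. \<forall>(a::'a) b. norm (cinner a b) \<le> norm a * norm b * K"
    by (intro exI[of _ 1]) (simp add: cinner_norm_le)
qed (simp_all add: cinner_add_left cinner_add_right cinner_scaleR_right cinner_scaleR_left)

interpretation cinner: bounded_bilinear "cinner :: 'a::complex_inner \<Rightarrow> 'a \<Rightarrow> complex"
  by (rule bounded_bilinear_cinner)

declare cinner.zero_left [simp] cinner.zero_right [simp]

lemmas cinner_simps = cinner_add_left cinner_add_right cinner.diff_left cinner.diff_right
  cinner_scaleC_left cinner_scaleC_right cinner_scaleR_left cinner_scaleR_right
  cinner.minus_left cinner.minus_right

lemma cinner_eqI: "u = v" if "\<And>x. cinner x u = cinner x v" for u v :: "'a::complex_inner"
proof -
  have "cinner (u - v) (u - v) = 0"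
    using that by (simp add: cinner.diff_right)
  then show ?thesis
    by (simp add: cinner_self)
qed

lemma cinner_eqI_left: "u = v" if "\<And>x. cinner u x = cinner v x" for u v :: "'a::complex_inner"
  using that by (metis cinner_commute cinner_eqI)

lemma bounded_clinearI:
  assumes "\<And>x y. T (x + y) = T x + T y" and "\<And>c x. T (c *\<^sub>C x) = c *\<^sub>C T x"
    and "\<And>x. norm (T x) \<le> b * norm x"
  shows "bounded_clinear (T::'a::complex_inner \<Rightarrow> 'a)"
  unfolding bounded_clinear_def
proof
  show "bounded_linear T"
    by (rule bounded_linear_intro[where K=b])
      (use assms in \<open>auto simp: scaleR_eq_scaleC mult.commute\<close>)
qed (use assms in auto)

lemma bounded_clinear_bl: "bounded_clinear T \<Longrightarrow> bounded_linear T"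
  by (simp add: bounded_clinear_def)

lemma bounded_clinear_scaleC: "bounded_clinear T \<Longrightarrow> T (c *\<^sub>C x) = c *\<^sub>C T x"
  by (simp add: bounded_clinear_def)

lemma bounded_clinear_add: "bounded_clinear T \<Longrightarrow> T (x + y) = T x + T y"
  by (simp add: bounded_clinear_def bounded_linear.linear linear_add)

lemma bounded_clinear_compose:
  "bounded_clinear S \<Longrightarrow> bounded_clinear T \<Longrightarrow> bounded_clinear (\<lambda>x. S (T x))"
  by (simp add: bounded_clinear_def bounded_linear_compose)

lemma bounded_clinear_sum:
  "(\<And>i. i \<in> I \<Longrightarrow> bounded_clinear (T i)) \<Longrightarrow> bounded_clinear (\<lambda>x. \<Sum>i\<in>I. T i x)"
proof (induction I rule: infinite_finite_induct)
  case (insert i I)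
  then show ?case
    by (auto simp: bounded_clinear_def scaleC_add_right intro!: bounded_linear_add)
qed (auto simp: bounded_clinear_def)

subsection \<open>Positive operators\<close>

lemma positive_op_bc: "positive_op T \<Longrightarrow> bounded_clinear T"
  by (simp add: positive_op_def)

lemma op_le_on_iff:
  "op_le_on K S T \<longleftrightarrow> (\<forall>h\<in>K. Im (cinner h (T h)) = Im (cinner h (S h)) \<and>
     Re (cinner h (S h)) \<le> Re (cinner h (T h)))"
  by (auto simp: op_le_on_def cinner.diff_right complex_nonneg_Reals_iff)

lemma positive_op_iff:
  "positive_op T \<longleftrightarrow> bounded_clinear T \<and>
     (\<forall>h. Im (cinner h (T h)) = 0 \<and> 0 \<le> Re (cinner h (T h)))"
  by (simp add: positive_op_def op_le_on_iff cinner.zero_right)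

lemma real_form_selfadjoint:
  assumes T: "bounded_clinear T" and r: "\<And>h. Im (cinner h (T h)) = 0"
  shows "selfadjoint T"
  unfolding selfadjoint_def
proof (intro allI)
  fix x y
  have 1: "Im (cinner x (T y)) + Im (cinner y (T x)) = 0"
    using r[of "x + y"] r[of x] r[of y] by (simp add: cinner_simps bounded_clinear_add[OF T])
  have 2: "Re (cinner x (T y)) - Re (cinner y (T x)) = 0"
    using r[of "x + \<i> *\<^sub>C y"] r[of x] r[of y]
    by (simp add: cinner_simps bounded_clinear_add[OF T] bounded_clinear_scaleC[OF T])
  have "cinner x (T y) = cnj (cinner y (T x))"
    using 1 2 by (intro complex_eqI) auto
  then show "cinner (T x) y = cinner x (T y)"
    by (metis cinner_commute)
qed

lemma positive_op_selfadjoint: "positive_op T \<Longrightarrow> selfadjoint T"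
  by (simp add: positive_op_iff real_form_selfadjoint)

lemma selfadjointD: "selfadjoint T \<Longrightarrow> cinner (T x) y = cinner x (T y)"
  by (simp add: selfadjoint_def)

text \<open>Nonnegativity of the form at \<open>x - T x / c\<close> replaces the Cauchy-Schwarz inequality for the
  form of \<open>T\<close>.\<close>

lemma positive_op_norm_sq_le:
  assumes T: "positive_op T" and c: "c > 0" and b: "\<And>x. norm (T x) \<le> c * norm x"
  shows "(norm (T x))\<^sup>2 \<le> c * Re (cinner x (T x))"
proof -
  let ?y = "x - (1/c) *\<^sub>R T x"
  have bl: "bounded_linear T"
    using T by (simp add: positive_op_def bounded_clinear_def)
  have Ty: "T ?y = T x - (1/c) *\<^sub>R T (T x)"
    by (simp add: bounded_linear.linear[OF bl] linear_diff linear_scale)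
  have s: "cinner x (T (T x)) = complex_of_real ((norm (T x))\<^sup>2)"
    using selfadjointD[OF positive_op_selfadjoint[OF T], of x "T x"] by (simp add: cinner_self)
  have "Re (cinner (T x) (T (T x))) \<le> norm (T x) * norm (T (T x))"
    by (rule order_trans[OF complex_Re_le_cmod cinner_norm_le])
  also have "\<dots> \<le> norm (T x) * (c * norm (T x))"
    by (intro mult_left_mono b) auto
  finally have 2: "Re (cinner (T x) (T (T x))) \<le> c * (norm (T x))\<^sup>2"
    by (simp add: power2_eq_square mult_ac)
  have "0 \<le> Re (cinner ?y (T ?y))"
    using T by (simp add: positive_op_iff)
  also have "\<dots> = Re (cinner x (T x)) - 2 / c * (norm (T x))\<^sup>2
      + (1/c)\<^sup>2 * Re (cinner (T x) (T (T x)))"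
    using c by (simp add: Ty cinner_simps s cinner_self field_simps power2_eq_square)
  also have "\<dots> \<le> Re (cinner x (T x)) - 2 / c * (norm (T x))\<^sup>2
      + (1/c)\<^sup>2 * (c * (norm (T x))\<^sup>2)"
    using 2 by (intro add_left_mono mult_left_mono) auto
  also have "\<dots> = Re (cinner x (T x)) - (norm (T x))\<^sup>2 / c"
    using c by (simp add: field_simps power2_eq_square)
  finally show ?thesis
    using c by (simp add: field_simps)
qed

lemma bounded_clinear_bound:
  assumes "bounded_clinear T"
  obtains c where "c > 0" "\<And>x. norm (T x) \<le> c * norm x"
  using bounded_linear.pos_bounded[OF bounded_clinear_bl[OF assms]]
  by (metis mult.commute)

lemma positive_op_eq_0:
  assumes T: "positive_op T" and "Re (cinner x (T x)) = 0"
  shows "T x = 0"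
proof -
  obtain c where "c > 0" "\<And>x. norm (T x) \<le> c * norm x"
    using bounded_clinear_bound positive_op_bc[OF T] by blast
  from positive_op_norm_sq_le[OF T this, of x] assms(2) show ?thesis
    by simp
qed

section \<open>Representation of functionals and forms\<close>

text \<open>The vector is the limit of a minimising sequence of \<open>\<parallel>d\<parallel>\<^sup>2 - 2 f d\<close> on the subspace, which is
  Cauchy by the parallelogram law.\<close>

lemma riesz_real:
  fixes D :: "'a::{real_inner,complete_space} set"
  assumes D: "subspace D"
    and add: "\<And>x y. x \<in> D \<Longrightarrow> y \<in> D \<Longrightarrow> f (x + y) = f x + f y"
    and sc: "\<And>r x. x \<in> D \<Longrightarrow> f (r *\<^sub>R x) = r * f x"
    and bd: "\<And>x. x \<in> D \<Longrightarrow> \<bar>f x\<bar> \<le> c * norm x"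
  shows "\<exists>u\<in>closure D. \<forall>d\<in>D. inner u d = (f d :: real)"
proof -
  define J where "J d = (norm d)\<^sup>2 - 2 * f d" for d
  have lb: "- c\<^sup>2 \<le> J d" if "d \<in> D" for d
  proof -
    have "0 \<le> (norm d - c)\<^sup>2" by simp
    then show ?thesis
      using bd[OF that] by (simp add: J_def power2_diff mult.commute)
  qed
  define I where "I = Inf (J ` D)"
  have bb: "bdd_below (J ` D)"
    using lb by (auto intro!: bdd_belowI)
  have ne: "D \<noteq> {}"
    using D subspace_0 by auto
  have I_le: "I \<le> J d" if "d \<in> D" for d
    unfolding I_def using bb that by (auto intro: cInf_lower)
  have "\<exists>d\<in>D. J d < I + 1 / real (Suc n)" for n
    using cInf_lessD[of "J ` D" "I + 1 / real (Suc n)"] ne by (auto simp: I_def)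
  then obtain d where dD: "\<And>n. d n \<in> D" and dJ: "\<And>n. J (d n) < I + 1 / real (Suc n)"
    by metis
  have par: "(norm (d p - d q))\<^sup>2 \<le> 2 * (1 / real (Suc p)) + 2 * (1 / real (Suc q))" for p q
  proof -
    let ?m = "(1/2) *\<^sub>R (d p + d q)"
    have mD: "?m \<in> D"
      using D dD by (intro subspace_scale subspace_add) auto
    have fm: "f ?m = (f (d p) + f (d q)) / 2"
      using dD D by (simp add: sc add subspace_add)
    have "(norm ?m)\<^sup>2 = (norm (d p + d q))\<^sup>2 / 4"
      by (simp only: norm_scaleR) (simp add: power_divide)
    then have "J ?m = (norm (d p + d q))\<^sup>2 / 4 - (f (d p) + f (d q))"
      unfolding J_def fm by (simp only:) (simp add: field_simps)
    moreover have "(norm (d p - d q))\<^sup>2 + (norm (d p + d q))\<^sup>2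
        = 2 * (norm (d p))\<^sup>2 + 2 * (norm (d q))\<^sup>2"
      by (simp add: power2_norm_eq_inner inner_simps inner_commute)
    ultimately have "(norm (d p - d q))\<^sup>2 = 2 * J (d p) + 2 * J (d q) - 4 * J ?m"
      by (simp add: J_def add_divide_distrib diff_divide_distrib)
    with I_le[OF mD] dJ[of p] dJ[of q] show ?thesis
      by linarith
  qed
  have "Cauchy d"
  proof (rule metric_CauchyI)
    fix e :: real assume e: "e > 0"
    obtain N where N: "4 / e\<^sup>2 < real N"
      using reals_Archimedean2 by blast
    show "\<exists>M. \<forall>p\<ge>M. \<forall>q\<ge>M. dist (d p) (d q) < e"
    proof (intro exI allI impI)
      fix p q assume pq: "p \<ge> N" "q \<ge> N"
      have "1 / real (Suc p) \<le> 1 / real (Suc N)" "1 / real (Suc q) \<le> 1 / real (Suc N)"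
        using pq by (auto intro!: divide_left_mono)
      then have "(norm (d p - d q))\<^sup>2 \<le> 4 * (1 / real (Suc N))"
        using par[of p q] by linarith
      also have "\<dots> < e\<^sup>2"
      proof -
        have "4 < real N * e\<^sup>2"
          using N e by (simp add: field_simps)
        also have "\<dots> \<le> real (Suc N) * e\<^sup>2"
          by (intro mult_right_mono) auto
        finally show ?thesis
          by (simp add: field_simps del: of_nat_Suc)
      qed
      finally show "dist (d p) (d q) < e"
        using e by (simp add: dist_norm power2_less_imp_less)
    qed
  qed
  then obtain u where u: "d \<longlonglongrightarrow> u"
    using Cauchy_convergent_iff convergent_def by blast
  show ?thesis
  proof (intro bexI[of _ u] ballI)
    show "u \<in> closure D"
      using u dD closure_sequential by blast
    fix v assume v: "v \<in> D"
    define z where "z = inner u v - f v"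
    have key: "0 \<le> 2 * t * z + t\<^sup>2 * (norm v)\<^sup>2" for t
    proof (rule LIMSEQ_le)
      show "(\<lambda>n. - (1 / real (Suc n))) \<longlonglongrightarrow> 0"
        using tendsto_minus[OF LIMSEQ_inverse_real_of_nat] by (simp add: inverse_eq_divide)
      show "(\<lambda>n. 2 * t * (inner (d n) v - f v) + t\<^sup>2 * (norm v)\<^sup>2)
          \<longlonglongrightarrow> 2 * t * z + t\<^sup>2 * (norm v)\<^sup>2"
        unfolding z_def by (intro tendsto_intros u)
      have "- (1 / real (Suc n)) \<le> 2 * t * (inner (d n) v - f v) + t\<^sup>2 * (norm v)\<^sup>2" for n
      proof -
        have "d n + t *\<^sub>R v \<in> D"
          using D dD v by (intro subspace_scale subspace_add) auto
        then have "I \<le> J (d n + t *\<^sub>R v)"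
          by (rule I_le)
        also have "J (d n + t *\<^sub>R v)
            = J (d n) + (2 * t * (inner (d n) v - f v) + t\<^sup>2 * (norm v)\<^sup>2)"
          using dD v D unfolding J_def power2_norm_eq_inner
          by (simp add: add sc subspace_scale inner_simps inner_commute algebra_simps
              power2_eq_square)
        finally show ?thesis
          using dJ[of n] by simp
      qed
      then show "\<exists>N. \<forall>n\<ge>N. - (1 / real (Suc n))
          \<le> 2 * t * (inner (d n) v - f v) + t\<^sup>2 * (norm v)\<^sup>2"
        by blast
    qed
    \<comment> \<open>The minimum over \<open>t\<close> of the right-hand side of \<open>key\<close> is \<open>- z\<^sup>2 / \<parallel>v\<parallel>\<^sup>2\<close>.\<close>
    have "z = 0"
    proof (cases "v = 0")
      case True
      then show ?thesis
        using sc[OF v, of 0] by (simp add: z_def)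
    next
      case False
      define N where "N = (norm v)\<^sup>2"
      have N: "N > 0"
        using False by (simp add: N_def)
      have "0 \<le> 2 * (- z / N) * z + (- z / N)\<^sup>2 * N"
        using key[of "- z / N"] by (simp only: N_def)
      also have "\<dots> = - (z\<^sup>2 / N)"
        using N by (simp add: power2_eq_square)
      finally have "z\<^sup>2 \<le> 0"
        using N by (simp add: divide_le_0_iff)
      then show ?thesis
        by simp
    qed
    then show "inner u v = f v"
      by (simp add: z_def)
  qed
qed

text \<open>Complex subspaces, not necessarily closed.\<close>

definition csubspace :: "'a::complex_inner set \<Rightarrow> bool" where
  "csubspace D \<longleftrightarrow> subspace D \<and> (\<forall>c. \<forall>x\<in>D. c *\<^sub>C x \<in> D)"

lemma csubspace_scaleC: "csubspace D \<Longrightarrow> x \<in> D \<Longrightarrow> c *\<^sub>C x \<in> D"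
  by (simp add: csubspace_def)

lemma bounded_clinear_scaleC_const: "bounded_clinear (\<lambda>x. c *\<^sub>C (x::'a::complex_inner))"
  by (rule bounded_clinearI[where b="norm c"])
    (auto simp: scaleC_add_right scaleC_scaleC norm_scaleC mult.commute)

lemma csubspace_closure: "csubspace (closure D)" if D: "csubspace (D::'a::complex_inner set)"
  unfolding csubspace_def
proof (intro conjI allI ballI)
  show "subspace (closure D)"
  proof (rule subspaceI)
    show "0 \<in> closure D"
      using D subspace_0 closure_subset[of D] by (auto simp: csubspace_def)
    show "x + y \<in> closure D" if "x \<in> closure D" "y \<in> closure D" for x y
    proof -
      obtain a b where "\<And>n. a n \<in> D" "a \<longlonglongrightarrow> x" "\<And>n. b n \<in> D" "b \<longlonglongrightarrow> y"
        using \<open>x \<in> closure D\<close> \<open>y \<in> closure D\<close> closure_sequential by metis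
      then have "\<forall>n. a n + b n \<in> D" "(\<lambda>n. a n + b n) \<longlonglongrightarrow> x + y"
        using D by (auto simp: csubspace_def subspace_add intro!: tendsto_add)
      then show ?thesis
        unfolding closure_sequential by (intro exI conjI)
    qed
    show "r *\<^sub>R x \<in> closure D" if "x \<in> closure D" for r x
    proof -
      obtain a where "\<And>n. a n \<in> D" "a \<longlonglongrightarrow> x"
        using \<open>x \<in> closure D\<close> closure_sequential by metis
      then have "\<forall>n. r *\<^sub>R a n \<in> D" "(\<lambda>n. r *\<^sub>R a n) \<longlonglongrightarrow> r *\<^sub>R x"
        using D by (auto simp: csubspace_def subspace_scale intro!: tendsto_intros)
      then show ?thesis
        unfolding closure_sequential by (intro exI conjI)
    qed
  qed
  fix c x assume x: "x \<in> closure D"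
  have "(\<lambda>x. c *\<^sub>C x) ` closure D \<subseteq> closure D"
  proof (rule image_closure_subset)
    show "continuous_on (closure D) (\<lambda>x. c *\<^sub>C x)"
      by (intro linear_continuous_on bounded_clinear_bl bounded_clinear_scaleC_const)
    show "(\<lambda>x. c *\<^sub>C x) ` D \<subseteq> closure D"
      using D closure_subset[of D] by (auto simp: csubspace_def)
  qed simp
  with x show "c *\<^sub>C x \<in> closure D"
    by blast
qed

lemma csubspace_range:
  assumes "bounded_clinear T"
  shows "csubspace (range T)"
proof -
  have "c *\<^sub>C T x \<in> range T" for c x
    using bounded_clinear_scaleC[OF assms] by (metis rangeI)
  then show ?thesis
    using assms
    by (auto simp: csubspace_def bounded_clinear_def bounded_linear.linear
        intro: linear_subspace_image)
qed

lemma closure_cinner_eq: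
  assumes "x \<in> closure D" and "\<And>d. d \<in> D \<Longrightarrow> cinner u d = cinner v d"
  shows "cinner u x = cinner v (x::'a::complex_inner)"
proof -
  obtain d where d: "\<And>n. d n \<in> D" "d \<longlonglongrightarrow> x"
    using assms(1) closure_sequential by blast
  have "(\<lambda>n. cinner u (d n)) \<longlonglongrightarrow> cinner u x" "(\<lambda>n. cinner v (d n)) \<longlonglongrightarrow> cinner v x"
    using d(2) by (auto intro!: cinner.tendsto)
  moreover have "(\<lambda>n. cinner u (d n)) = (\<lambda>n. cinner v (d n))"
    using assms(2) d(1) by auto
  ultimately show ?thesis
    using LIMSEQ_unique by metis
qed

text \<open>A bounded functional on a subspace is represented by a unique vector of the closure. Taking
  the subspace not closed makes the extension of operators from a dense subspace a special case.\<close>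

lemma riesz_complex:
  fixes D :: "'a::complex_hilbert set"
  assumes D: "csubspace D"
    and add: "\<And>x y. x \<in> D \<Longrightarrow> y \<in> D \<Longrightarrow> f (x + y) = f x + f y"
    and sc: "\<And>c x. x \<in> D \<Longrightarrow> f (c *\<^sub>C x) = c * f x"
    and bd: "\<And>x. x \<in> D \<Longrightarrow> norm (f x) \<le> c * norm x" and c: "c \<ge> 0"
  shows "\<exists>u\<in>closure D. (\<forall>d\<in>D. cinner u d = f d) \<and> norm u \<le> c"
proof -
  have "\<exists>u\<in>closure D. \<forall>d\<in>D. inner u d = Re (f d)"
  proof (rule riesz_real)
    show "subspace D" using D by (simp add: csubspace_def)
    show "\<bar>Re (f x)\<bar> \<le> c * norm x" if "x \<in> D" for x
      using bd[OF that] abs_Re_le_cmod order_trans by blast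
  qed (auto simp: add sc scaleR_eq_scaleC)
  then obtain u where u: "u \<in> closure D" and ur: "\<And>d. d \<in> D \<Longrightarrow> Re (cinner u d) = Re (f d)"
    by (auto simp: inner_eq_Re_cinner)
  have ud: "cinner u d = f d" if "d \<in> D" for d
  proof (rule complex_eqI)
    show "Re (cinner u d) = Re (f d)"
      by (rule ur[OF that])
    \<comment> \<open>The imaginary part is the real part at a rotated vector.\<close>
    show "Im (cinner u d) = Im (f d)"
      using ur[OF csubspace_scaleC[OF D that, of \<i>]] that by (simp add: sc cinner_scaleC_right)
  qed
  obtain d where d: "\<And>n. d n \<in> D" "d \<longlonglongrightarrow> u"
    using u closure_sequential by blast
  have "norm (cinner u u) \<le> c * norm u"
  proof (rule LIMSEQ_le)
    show "(\<lambda>n. norm (cinner u (d n))) \<longlonglongrightarrow> norm (cinner u u)"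
      using d(2) by (intro tendsto_norm cinner.tendsto) auto
    show "(\<lambda>n. c * norm (d n)) \<longlonglongrightarrow> c * norm u"
      using d(2) by (intro tendsto_intros)
  qed (use d(1) ud bd in auto)
  then have "norm u * norm u \<le> c * norm u"
    by (simp only: norm_cinner_self power2_eq_square)
  then have "norm u \<le> c"
    using c by (cases "norm u = 0") auto
  with u ud show ?thesis
    by blast
qed

text \<open>A bounded sesquilinear form is the form of an operator.\<close>

lemma form_operator:
  fixes s :: "'a::complex_hilbert \<Rightarrow> 'a \<Rightarrow> complex"
  assumes addl: "\<And>x y z. s (x + y) z = s x z + s y z"
    and addr: "\<And>x y z. s x (y + z) = s x y + s x z"
    and scl: "\<And>c x y. s (c *\<^sub>C x) y = cnj c * s x y"
    and scr: "\<And>c x y. s x (c *\<^sub>C y) = c * s x y"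
    and bd: "\<And>x y. norm (s x y) \<le> b * norm x * norm y" and b: "b \<ge> 0"
  obtains T where "bounded_clinear T" "\<And>x y. cinner x (T y) = s x y"
    "\<And>x. norm (T x) \<le> b * norm x"
proof -
  have "\<exists>u. (\<forall>x. cinner u x = cnj (s x y)) \<and> norm u \<le> b * norm y" for y
    using riesz_complex[of UNIV "\<lambda>x. cnj (s x y)" "b * norm y"] b bd[of _ y]
    by (auto simp: csubspace_def addl scl mult_ac)
  then obtain T where T: "\<And>x y. cinner (T y) x = cnj (s x y)" "\<And>y. norm (T y) \<le> b * norm y"
    by metis
  have T': "cinner x (T y) = s x y" for x y
    by (metis T(1) cinner_commute complex_cnj_cnj)
  have "bounded_clinear T"
    by (rule bounded_clinearI[OF _ _ T(2)]; rule cinner_eqI)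
      (simp_all add: T' addr scr cinner_add_right cinner_scaleC_right)
  with that T(2) T' show ?thesis
    by blast
qed

lemma cadjoint_eqI:
  assumes "\<And>x y. cinner (S x) y = cinner x (T y)"
  shows "cadjoint T = (S::'a::complex_inner \<Rightarrow> 'a)"
  unfolding cadjoint_def
proof (rule the_equality)
  show "S' = S" if "\<forall>x y. cinner (S' x) y = cinner x (T y)" for S'
    by (rule ext, rule cinner_eqI_left) (simp add: that assms)
qed (use assms in simp)

lemma cadjoint_exists:
  fixes T :: "'a::complex_hilbert \<Rightarrow> 'a"
  assumes T: "bounded_clinear T"
  shows "bounded_clinear (cadjoint T)" and "cinner (cadjoint T x) y = cinner x (T y)"
proof -
  obtain c where c: "c > 0" "\<And>x. norm (T x) \<le> c * norm x"
    using bounded_clinear_bound[OF T] by blast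
  obtain S where S: "bounded_clinear S" "\<And>x y. cinner x (S y) = cinner (T x) y"
  proof (rule form_operator[of "\<lambda>x y. cinner (T x) y" c])
    show "norm (cinner (T x) y) \<le> c * norm x * norm y" for x y
      using mult_right_mono[OF c(2)[of x], of "norm y"] cinner_norm_le[of "T x" y] by simp
  qed (use c in \<open>auto simp: bounded_clinear_add[OF T] bounded_clinear_scaleC[OF T] cinner_simps\<close>)
  have *: "cinner (S x) y = cinner x (T y)" for x y
    by (metis S(2) cinner_commute)
  then have "cadjoint T = S"
    by (rule cadjoint_eqI)
  with S * show "bounded_clinear (cadjoint T)" "cinner (cadjoint T x) y = cinner x (T y)"
    by auto
qed

lemma projection_exists:
  fixes K :: "'a::complex_hilbert set"
  assumes K: "csubspace K" "closed K"
  obtains p where "p \<in> K" "x - p \<in> orth_compl K"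
proof -
  obtain p where "p \<in> K" "\<forall>d\<in>K. cinner p d = cinner x d"
    using riesz_complex[of K "cinner x" "norm x"] K
    by (auto simp: cinner_add_right cinner_scaleC_right cinner_norm_le)
  then have "cinner d (x - p) = 0" if "d \<in> K" for d
    using that by (metis cinner.diff_right cinner_commute right_minus_eq)
  with that[OF \<open>p \<in> K\<close>] show ?thesis
    by (simp add: orth_compl_def)
qed

lemma orth_compl_orth_compl_subset:
  fixes K :: "'a::complex_hilbert set"
  assumes K: "csubspace K" "closed K" and x: "\<And>y. y \<in> orth_compl K \<Longrightarrow> cinner y x = 0"
  shows "x \<in> K"
proof -
  obtain p where p: "p \<in> K" "x - p \<in> orth_compl K"
    using projection_exists[OF K] by blast
  have "cinner (x - p) x = 0" "cinner p (x - p) = 0"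
    using p x by (auto simp: orth_compl_def)
  then have "cinner (x - p) (x - p) = 0"
    using cinner_commute[of "x - p" p] by (simp add: cinner.diff_right[of "x - p" x p])
  then have "x = p"
    by (simp add: cinner_self)
  with p show ?thesis
    by simp
qed

lemma bops_eqI:
  fixes K :: "'a::complex_hilbert set"
  assumes K: "csubspace K" "closed K" and TS: "T \<in> bops K L" "S \<in> bops K L'"
    and eq: "\<And>x. x \<in> K \<Longrightarrow> T x = S x"
  shows "T = S"
proof
  fix x
  obtain p where p: "p \<in> K" "x - p \<in> orth_compl K"
    using projection_exists[OF K] by blast
  have "T (x - p) = 0" "S (x - p) = 0" "bounded_clinear T" "bounded_clinear S"
    using p(2) TS by (auto simp: bops_def)
  then have "T x = T p" "S x = S p"
    using bounded_clinear_add[of T p "x - p"] bounded_clinear_add[of S p "x - p"] by auto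
  then show "T x = S x"
    using eq[OF p(1)] by simp
qed

lemma bops_eqI_range:
  fixes S :: "'a::complex_hilbert \<Rightarrow> 'a"
  assumes S: "bounded_clinear S" and TT: "T \<in> bops (closure (range S)) L"
    "T' \<in> bops (closure (range S)) L'" and eq: "\<And>x. T (S x) = T' (S x)"
  shows "T = T'"
proof (rule bops_eqI[OF csubspace_closure[OF csubspace_range[OF S]] closed_closure TT])
  have c: "continuous_on UNIV T" "continuous_on UNIV T'"
    using TT by (auto simp: bops_def bounded_clinear_bl linear_continuous_on)
  have "closed {x. T x = T' x}"
    by (rule closed_Collect_eq[OF c])
  then have "closure (range S) \<subseteq> {x. T x = T' x}"
    using eq by (intro closure_minimal) auto
  then show "T x = T' x" if "x \<in> closure (range S)" for x
    using that by auto
qed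

text \<open>Douglas factorisation. The adjoint of the factor is obtained first: its value at \<open>k\<close>
  represents the functional \<open>S h \<mapsto> \<langle>k, R h\<rangle>\<close> on the range of \<open>S\<close>.\<close>

lemma douglas:
  fixes S R :: "'a::complex_hilbert \<Rightarrow> 'a"
  assumes S: "bounded_clinear S" and R: "bounded_clinear R"
    and c: "c \<ge> 0" and le: "\<And>h. norm (R h) \<le> c * norm (S h)"
  obtains D where "D \<in> bops (closure (range S)) (closure (range R))"
    "\<And>h. D (S h) = R h" "\<And>x. norm (D x) \<le> c * norm x"
proof -
  let ?K = "closure (range S)" and ?L = "closure (range R)"
  have K: "csubspace ?K" "closed ?K" and L: "csubspace ?L" "closed ?L"
    by (auto intro: csubspace_closure csubspace_range S R)
  have sR: "R x = R y" if "S x = S y" for x y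
  proof -
    have "norm (R (x - y)) \<le> c * norm (S (x - y))" by (rule le)
    also have "S (x - y) = 0"
      using that S by (simp add: bounded_clinear_def bounded_linear.linear linear_diff)
    finally have "R (x - y) = 0" by simp
    then show ?thesis
      using R by (simp add: bounded_clinear_def bounded_linear.linear linear_diff)
  qed
  \<comment> \<open>By \<open>sR\<close>, the choice of a preimage under \<open>S\<close> does not matter.\<close>
  define G where "G d = R (SOME h. S h = d)" for d
  have G: "G (S h) = R h" for h
    unfolding G_def by (rule sR) (rule someI[of "\<lambda>x. S x = S h" h], simp)
  have "\<exists>u\<in>?K. (\<forall>d\<in>range S. cinner u d = cinner k (G d)) \<and> norm u \<le> c * norm k" for k
  proof (rule riesz_complex)
    show "csubspace (range S)"
      by (rule csubspace_range[OF S])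
    show "cinner k (G (x + y)) = cinner k (G x) + cinner k (G y)"
      if xy: "x \<in> range S" "y \<in> range S" for x y
    proof -
      obtain a b where "x = S a" "y = S b"
        using xy by auto
      then show ?thesis
        using G[of "a + b"] G
        by (simp add: bounded_clinear_add[OF S] bounded_clinear_add[OF R] cinner_add_right)
    qed
    show "cinner k (G (r *\<^sub>C x)) = r * cinner k (G x)" if "x \<in> range S" for x r
    proof -
      obtain a where "x = S a"
        using \<open>x \<in> range S\<close> by auto
      then show ?thesis
        using G[of "r *\<^sub>C a"] G
        by (simp add: bounded_clinear_scaleC[OF S] bounded_clinear_scaleC[OF R]
            cinner_scaleC_right)
    qed
    show "norm (cinner k (G x)) \<le> c * norm k * norm x" if x: "x \<in> range S" for x
    proof -
      have "norm (cinner k (G x)) \<le> norm k * norm (G x)"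
        by (rule cinner_norm_le)
      also have "\<dots> \<le> norm k * (c * norm x)"
        using x G le by (intro mult_left_mono) auto
      finally show ?thesis
        by (simp add: mult_ac)
    qed
  qed (use c in auto)
  then obtain U where UK: "\<And>k. U k \<in> ?K" and U: "\<And>k h. cinner (U k) (S h) = cinner k (R h)"
    and Un: "\<And>k. norm (U k) \<le> c * norm k"
    using G by (metis rangeI)
  have Ueq: "U k = v" if v: "v \<in> ?K" "\<And>h. cinner v (S h) = cinner k (R h)" for k v
  proof -
    have "U k - v \<in> ?K"
      using K(1) UK v(1) by (simp add: csubspace_def subspace_diff)
    moreover have "cinner (U k) d = cinner v d" if "d \<in> range S" for d
      using that U v(2) by auto
    ultimately have "cinner (U k) (U k - v) = cinner v (U k - v)"
      by (rule closure_cinner_eq)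
    then have "cinner (U k - v) (U k - v) = 0"
      by (simp add: cinner.diff_left)
    then show ?thesis
      by (simp add: cinner_self)
  qed
  have Ubc: "bounded_clinear U"
  proof (rule bounded_clinearI[OF _ _ Un])
    show "U (x + y) = U x + U y" for x y
      by (rule Ueq) (use K(1) UK in \<open>auto simp: csubspace_def subspace_add U cinner_simps\<close>)
    show "U (r *\<^sub>C x) = r *\<^sub>C U x" for r x
      by (rule Ueq) (use K(1) UK in \<open>auto simp: csubspace_def U cinner_simps\<close>)
  qed
  define D where "D = cadjoint U"
  have Dbc: "bounded_clinear D" and D: "\<And>x y. cinner (D x) y = cinner x (U y)"
    using cadjoint_exists[OF Ubc] by (auto simp: D_def)
  have D': "cinner y (D x) = cinner (U y) x" for x y
    by (metis D cinner_commute)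
  show ?thesis
  proof (rule that)
    show "D (S h) = R h" for h
      by (rule cinner_eqI) (simp add: D' U)
    show "norm (D x) \<le> c * norm x" for x
    proof -
      have "norm (D x) * norm (D x) = norm (cinner (D x) (D x))"
        by (simp only: norm_cinner_self power2_eq_square)
      also have "\<dots> = norm (cinner (U (D x)) x)"
        by (simp add: D')
      also have "\<dots> \<le> norm (U (D x)) * norm x"
        by (rule cinner_norm_le)
      also have "\<dots> \<le> c * norm (D x) * norm x"
        by (intro mult_right_mono Un) auto
      finally have "norm (D x) * norm (D x) \<le> norm (D x) * (c * norm x)"
        by (simp add: mult_ac)
      then show ?thesis
        using c by (cases "norm (D x) = 0") auto
    qed
    show "D \<in> bops ?K ?L"
      unfolding bops_def
    proof (intro CollectI conjI Dbc ballI subsetI)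
      fix x assume x: "x \<in> orth_compl ?K"
      show "D x = 0"
        by (rule cinner_eqI) (use x UK in \<open>auto simp: D' orth_compl_def cinner.zero_right\<close>)
    next
      fix y assume "y \<in> range D"
      then obtain x where y: "y = D x"
        by auto
      show "y \<in> ?L"
      proof (rule orth_compl_orth_compl_subset[OF L])
        fix k assume k: "k \<in> orth_compl ?L"
        have "cinner (R h) k = 0" for h
          using k closure_subset[of "range R"] by (auto simp: orth_compl_def)
        then have "cinner k (R h) = 0" for h
          using cinner_commute[of k "R h"] by simp
        moreover have "0 \<in> ?K"
          using K(1) by (simp add: csubspace_def subspace_0)
        ultimately have "U k = 0"
          by (intro Ueq) auto
        then show "cinner k y = 0"
          by (simp add: y D')
      qed
    qed
  qed
qed

section \<open>Square roots of positive operators\<close>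

text \<open>For \<open>\<parallel>B\<parallel> \<le> 1\<close>, the iteration \<open>Y \<mapsto> (B + Y\<^sup>2) / 2\<close> from \<open>0\<close> converges in norm to a solution of
  \<open>(1 - Y)\<^sup>2 = 1 - B\<close> with \<open>\<parallel>Y\<parallel> \<le> 1\<close>.\<close>

fun sqrt_iter :: "('a::real_normed_vector \<Rightarrow>\<^sub>L 'a) \<Rightarrow> nat \<Rightarrow> ('a \<Rightarrow>\<^sub>L 'a)" where
  "sqrt_iter B 0 = 0"
| "sqrt_iter B (Suc n) = (1/2) *\<^sub>R (B + (sqrt_iter B n o\<^sub>L sqrt_iter B n))"

text \<open>The same iteration for the number 1; it bounds the norms and the steps of
  \<^const>\<open>sqrt_iter\<close>.\<close>

fun sqrt_iter_bound :: "nat \<Rightarrow> real" where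
  "sqrt_iter_bound 0 = 0"
| "sqrt_iter_bound (Suc n) = (1 + (sqrt_iter_bound n)\<^sup>2) / 2"

lemma sqrt_iter_bound_range: "0 \<le> sqrt_iter_bound n \<and> sqrt_iter_bound n \<le> 1"
proof (induction n)
  case (Suc n)
  then have "(sqrt_iter_bound n)\<^sup>2 \<le> 1"
    by (simp add: abs_square_le_1)
  then show ?case
    by simp
qed simp

lemma sqrt_iter_bound_mono: "sqrt_iter_bound n \<le> sqrt_iter_bound (Suc n)"
proof -
  have "0 \<le> (sqrt_iter_bound n - 1)\<^sup>2"
    by simp
  then show ?thesis
    by (simp add: power2_diff)
qed

lemma sqrt_iter_bound_Cauchy: "Cauchy sqrt_iter_bound"
proof -
  have "incseq sqrt_iter_bound"
    by (rule incseq_SucI) (rule sqrt_iter_bound_mono)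
  then obtain L where "sqrt_iter_bound \<longlonglongrightarrow> L"
    using incseq_convergent[of sqrt_iter_bound 1] sqrt_iter_bound_range by metis
  then show ?thesis
    by (rule LIMSEQ_imp_Cauchy)
qed

lemmas blinfun_compose_simps = bounded_bilinear.add_left[OF bounded_bilinear_blinfun_compose]
  bounded_bilinear.add_right[OF bounded_bilinear_blinfun_compose]
  bounded_bilinear.diff_left[OF bounded_bilinear_blinfun_compose]
  bounded_bilinear.diff_right[OF bounded_bilinear_blinfun_compose]
  bounded_bilinear.scaleR_left[OF bounded_bilinear_blinfun_compose]
  bounded_bilinear.scaleR_right[OF bounded_bilinear_blinfun_compose]

lemma blinfun_compose_assoc: "A o\<^sub>L (B o\<^sub>L C) = (A o\<^sub>L B) o\<^sub>L C"
  by (rule blinfun_eqI) simp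

lemma sqrt_iter_commute:
  assumes "Z o\<^sub>L B = B o\<^sub>L Z"
  shows "Z o\<^sub>L sqrt_iter B n = sqrt_iter B n o\<^sub>L Z"
proof (induction n)
  case (Suc n)
  have "Z o\<^sub>L (sqrt_iter B n o\<^sub>L sqrt_iter B n) = (sqrt_iter B n o\<^sub>L sqrt_iter B n) o\<^sub>L Z"
    using Suc by (metis blinfun_compose_assoc)
  then show ?case
    by (simp add: blinfun_compose_simps assms)
qed (simp add: bounded_bilinear.zero_left[OF bounded_bilinear_blinfun_compose]
      bounded_bilinear.zero_right[OF bounded_bilinear_blinfun_compose])

lemma sqrt_iter_norm:
  assumes B: "norm B \<le> 1"
  shows "norm (sqrt_iter B n) \<le> sqrt_iter_bound n"
proof (induction n)
  case (Suc n)
  have "norm (sqrt_iter B n o\<^sub>L sqrt_iter B n) \<le> norm (sqrt_iter B n) * norm (sqrt_iter B n)"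
    by (rule norm_blinfun_compose)
  also have "\<dots> \<le> (sqrt_iter_bound n)\<^sup>2"
    unfolding power2_eq_square using Suc sqrt_iter_bound_range[of n] by (intro mult_mono) auto
  finally have "norm (B + (sqrt_iter B n o\<^sub>L sqrt_iter B n)) \<le> 1 + (sqrt_iter_bound n)\<^sup>2"
    using B by (intro norm_triangle_le) auto
  then show ?case
    by simp
qed simp

text \<open>Since successive iterates commute, a step is half the product of the previous step with the
  sum of the two iterates.\<close>

lemma sqrt_iter_step:
  assumes B: "norm B \<le> 1"
  shows "norm (sqrt_iter B (Suc n) - sqrt_iter B n) \<le> sqrt_iter_bound (Suc n) - sqrt_iter_bound n"
proof (induction n)
  case 0
  then show ?case
    using B by (simp add: bounded_bilinear.zero_left[OF bounded_bilinear_blinfun_compose])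
next
  case (Suc n)
  define Y Y' where "Y = sqrt_iter B n" and "Y' = sqrt_iter B (Suc n)"
  define y y' where "y = sqrt_iter_bound n" and "y' = sqrt_iter_bound (Suc n)"
  have "Y o\<^sub>L B = B o\<^sub>L Y"
    unfolding Y_def by (rule sqrt_iter_commute[symmetric]) simp
  then have "Y o\<^sub>L Y' = Y' o\<^sub>L Y"
    unfolding Y'_def Y_def by (rule sqrt_iter_commute)
  then have "sqrt_iter B (Suc (Suc n)) - sqrt_iter B (Suc n) = (1/2) *\<^sub>R ((Y' - Y) o\<^sub>L (Y' + Y))"
    unfolding sqrt_iter.simps(2)[of B "Suc n"] Y'_def[symmetric]
    using sqrt_iter.simps(2)[of B n, folded Y_def Y'_def]
    by (simp add: blinfun_compose_simps algebra_simps)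
  then have "norm (sqrt_iter B (Suc (Suc n)) - sqrt_iter B (Suc n))
      = norm ((Y' - Y) o\<^sub>L (Y' + Y)) / 2"
    by simp
  also have "\<dots> \<le> norm (Y' - Y) * norm (Y' + Y) / 2"
    by (intro divide_right_mono norm_blinfun_compose) auto
  also have "\<dots> \<le> (y' - y) * (y' + y) / 2"
  proof (intro divide_right_mono mult_mono)
    show "norm (Y' - Y) \<le> y' - y"
      using Suc by (simp only: Y_def Y'_def y_def y'_def)
    show "norm (Y' + Y) \<le> y' + y"
      unfolding Y_def Y'_def y_def y'_def by (intro norm_triangle_mono sqrt_iter_norm B)
    show "0 \<le> y' - y"
      using sqrt_iter_bound_mono[of n] by (simp only: y_def y'_def)
  qed auto
  also have "\<dots> = (1 + y'\<^sup>2) / 2 - (1 + y\<^sup>2) / 2"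
    by (simp add: power2_eq_square field_simps)
  also have "\<dots> = sqrt_iter_bound (Suc (Suc n)) - sqrt_iter_bound (Suc n)"
    by (simp only: y_def y'_def sqrt_iter_bound.simps(2))
  finally show ?case .
qed

lemma sqrt_iter_limit:
  fixes B :: "'a::banach \<Rightarrow>\<^sub>L 'a"
  assumes B: "norm B \<le> 1"
  obtains Y where "sqrt_iter B \<longlonglongrightarrow> Y" "norm Y \<le> 1" "2 *\<^sub>R Y = B + (Y o\<^sub>L Y)"
proof -
  have diff: "norm (sqrt_iter B (n + k) - sqrt_iter B n)
      \<le> sqrt_iter_bound (n + k) - sqrt_iter_bound n" for n k
  proof (induction k)
    case (Suc k)
    have "norm (sqrt_iter B (n + Suc k) - sqrt_iter B n)
        \<le> norm (sqrt_iter B (Suc (n + k)) - sqrt_iter B (n + k))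
          + norm (sqrt_iter B (n + k) - sqrt_iter B n)"
      using norm_triangle_ineq[of "sqrt_iter B (Suc (n + k)) - sqrt_iter B (n + k)"
          "sqrt_iter B (n + k) - sqrt_iter B n"]
      by (simp del: sqrt_iter.simps)
    with Suc sqrt_iter_step[OF B, of "n + k"] show ?case
      unfolding add_Suc_right by linarith
  qed simp
  have "Cauchy (sqrt_iter B)"
  proof (rule metric_CauchyI)
    fix e :: real assume "e > 0"
    then obtain M where M: "\<And>p q. p \<ge> M \<Longrightarrow> q \<ge> M \<Longrightarrow> dist (sqrt_iter_bound p) (sqrt_iter_bound q) < e"
      using sqrt_iter_bound_Cauchy unfolding Cauchy_def by metis
    have *: "dist (sqrt_iter B p) (sqrt_iter B q) < e" if "q \<ge> M" "p \<ge> q" for p q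
      using diff[of q "p - q"] M[of p q] that by (simp add: dist_norm)
    show "\<exists>M. \<forall>p\<ge>M. \<forall>q\<ge>M. dist (sqrt_iter B p) (sqrt_iter B q) < e"
      by (metis * dist_commute nat_le_linear)
  qed
  then obtain Y where Y: "sqrt_iter B \<longlonglongrightarrow> Y"
    using Cauchy_convergent_iff convergent_def by blast
  show ?thesis
  proof (rule that[OF Y])
    show "norm Y \<le> 1"
      by (rule LIMSEQ_le_const2[OF tendsto_norm[OF Y]])
        (use sqrt_iter_norm[OF B] sqrt_iter_bound_range order_trans in blast)
    have "(\<lambda>n. sqrt_iter B (Suc n)) \<longlonglongrightarrow> (1/2) *\<^sub>R (B + (Y o\<^sub>L Y))"
      unfolding sqrt_iter.simps
      by (intro tendsto_intros bounded_bilinear.tendsto[OF bounded_bilinear_blinfun_compose] Y)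
    moreover have "(\<lambda>n. sqrt_iter B (Suc n)) \<longlonglongrightarrow> Y"
      using Y by (rule LIMSEQ_Suc)
    ultimately have "Y = (1/2) *\<^sub>R (B + (Y o\<^sub>L Y))"
      using LIMSEQ_unique by blast
    then show "2 *\<^sub>R Y = B + (Y o\<^sub>L Y)"
      by (metis (no_types) scaleR_scaleR scaleR_one nonzero_mult_div_cancel_left
          times_divide_eq_right mult.right_neutral zero_neq_numeral)
  qed
qed

lemma sqrt_iter_symmetric:
  assumes "\<And>x y. inner (blinfun_apply B x) y = inner x (blinfun_apply B (y::'a::real_inner))"
  shows "inner (blinfun_apply (sqrt_iter B n) x) y = inner x (blinfun_apply (sqrt_iter B n) y)"
proof (induction n arbitrary: x y)
  case (Suc n)
  then show ?case
    by (simp add: blinfun.bilinear_simps assms inner_simps)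
qed simp

text \<open>The root constructed here also commutes with the commutant of the operator, which is what
  its uniqueness rests on.\<close>

lemma positive_op_sqrt_exists:
  fixes T :: "'a::complex_hilbert \<Rightarrow> 'a"
  assumes T: "positive_op T"
  obtains S where "positive_op S" "\<And>x. S (S x) = T x"
    "\<And>Z x. bounded_linear Z \<Longrightarrow> (\<And>x. Z (T x) = T (Z x)) \<Longrightarrow> Z (S x) = S (Z x)"
proof -
  have Tbc: "bounded_clinear T"
    using T by (rule positive_op_bc)
  obtain c where c: "c > 0" "\<And>x. norm (T x) \<le> c * norm x"
    using bounded_clinear_bound[OF Tbc] by blast
  \<comment> \<open>With \<open>B = 1 - T / c\<close>, the limit \<open>Y\<close> satisfies \<open>(1 - Y)\<^sup>2 = T / c\<close>, and \<open>S = \<surd>c (1 - Y)\<close>.\<close>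
  have blB: "bounded_linear (\<lambda>x. x - (1/c) *\<^sub>R T x)"
    by (intro bounded_linear_sub bounded_linear_ident
        bounded_linear_compose[OF bounded_linear_scaleR_right bounded_clinear_bl[OF Tbc]])
  define B where "B = Blinfun (\<lambda>x. x - (1/c) *\<^sub>R T x)"
  have B: "blinfun_apply B x = x - (1/c) *\<^sub>R T x" for x
    by (simp add: B_def bounded_linear_Blinfun_apply[OF blB])
  have nB: "norm B \<le> 1"
  proof (rule norm_blinfun_bound)
    fix x
    have "(norm (x - (1/c) *\<^sub>R T x))\<^sup>2
        = Re (cinner (x - (1/c) *\<^sub>R T x) (x - (1/c) *\<^sub>R T x))"
      by (simp only: Re_cinner_self)
    also have "\<dots> = (norm x)\<^sup>2 - 2 / c * Re (cinner x (T x)) + (norm (T x))\<^sup>2 / c\<^sup>2"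
      using c selfadjointD[OF positive_op_selfadjoint[OF T], of x x]
      by (simp add: cinner_simps Re_cinner_self power2_eq_square diff_divide_distrib)
    also have "\<dots> \<le> (norm x)\<^sup>2"
    proof -
      have "(norm (T x))\<^sup>2 / c\<^sup>2 \<le> c * Re (cinner x (T x)) / c\<^sup>2"
        using positive_op_norm_sq_le[OF T c] by (intro divide_right_mono) auto
      also have "\<dots> = 1 / c * Re (cinner x (T x))"
        using c by (simp add: power2_eq_square)
      also have "\<dots> \<le> 2 / c * Re (cinner x (T x))"
        using c T by (intro mult_right_mono divide_right_mono) (auto simp: positive_op_iff)
      finally show ?thesis
        by simp
    qed
    finally have "norm (x - (1/c) *\<^sub>R T x) \<le> norm x"
      by (rule power2_le_imp_le) simp
    then show "norm (blinfun_apply B x) \<le> 1 * norm x"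
      by (simp add: B)
  qed simp
  obtain Y where Y: "sqrt_iter B \<longlonglongrightarrow> Y" and nY: "norm Y \<le> 1" and YY: "2 *\<^sub>R Y = B + (Y o\<^sub>L Y)"
    using sqrt_iter_limit[OF nB] by blast
  have Yx: "(\<lambda>n. blinfun_apply (sqrt_iter B n) x) \<longlonglongrightarrow> blinfun_apply Y x" for x
    by (intro blinfun.tendsto Y tendsto_const)
  have comm: "Z (blinfun_apply Y x) = blinfun_apply Y (Z x)"
    if Z: "bounded_linear Z" "\<And>x. Z (T x) = T (Z x)" for Z x
  proof -
    have "Blinfun Z o\<^sub>L B = B o\<^sub>L Blinfun Z"
      by (rule blinfun_eqI)
        (simp add: bounded_linear_Blinfun_apply[OF Z(1)] B Z(2) linear_diff linear_scale
          bounded_linear.linear[OF Z(1)])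
    then have "Blinfun Z o\<^sub>L sqrt_iter B n = sqrt_iter B n o\<^sub>L Blinfun Z" for n
      by (rule sqrt_iter_commute)
    then have *: "Z (blinfun_apply (sqrt_iter B n) x) = blinfun_apply (sqrt_iter B n) (Z x)" for n
      using bounded_linear_Blinfun_apply[OF Z(1)] by (metis blinfun_apply_blinfun_compose)
    show ?thesis
      using bounded_linear.tendsto[OF Z(1) Yx[of x]] Yx[of "Z x"] unfolding *
      by (rule LIMSEQ_unique)
  qed
  have symB: "inner (blinfun_apply B x) y = inner x (blinfun_apply B y)" for x y
    using selfadjointD[OF positive_op_selfadjoint[OF T], of x y]
    by (simp add: B inner_simps inner_eq_Re_cinner cinner_simps)
  have symY: "inner (blinfun_apply Y x) y = inner x (blinfun_apply Y y)" for x y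
    using tendsto_inner[OF Yx[of x] tendsto_const, of y] tendsto_inner[OF tendsto_const Yx[of y], of x]
    unfolding sqrt_iter_symmetric[OF symB] by (rule LIMSEQ_unique)
  define S where "S x = sqrt c *\<^sub>R (x - blinfun_apply Y x)" for x
  have blS: "bounded_linear S"
    unfolding S_def
    by (intro bounded_linear_compose[OF bounded_linear_scaleR_right] bounded_linear_sub
        bounded_linear_ident blinfun.bounded_linear_right)
  have cY: "blinfun_apply Y (r *\<^sub>C x) = r *\<^sub>C blinfun_apply Y x" for r x
    by (rule comm[symmetric])
      (auto simp: bounded_clinear_bl[OF bounded_clinear_scaleC_const] bounded_clinear_scaleC[OF Tbc])
  have cdiff: "r *\<^sub>C (x - y) = r *\<^sub>C x - r *\<^sub>C y" for r and x y :: 'a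
    using bounded_linear.linear[OF bounded_clinear_bl[OF bounded_clinear_scaleC_const]]
    by (rule linear_diff)
  have Sbc: "bounded_clinear S"
    unfolding bounded_clinear_def
    by (intro conjI blS) (simp add: S_def cY cdiff[symmetric] scaleR_eq_scaleC scaleC_scaleC mult.commute)
  have pos: "0 \<le> inner h (S h)" for h
  proof -
    have "inner h (blinfun_apply Y h) \<le> norm h * norm (blinfun_apply Y h)"
      by (rule norm_cauchy_schwarz)
    also have "\<dots> \<le> norm h * (norm Y * norm h)"
      by (intro mult_left_mono norm_blinfun) auto
    also have "\<dots> \<le> norm h * (1 * norm h)"
      using nY by (intro mult_left_mono mult_right_mono) auto
    also have "\<dots> = inner h h"
      by (simp add: power2_norm_eq_inner[symmetric] power2_eq_square)
    finally show ?thesis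
      using c by (simp add: S_def inner_simps)
  qed
  \<comment> \<open>The imaginary part of the form vanishes by real symmetry, tested on \<open>h\<close> and \<open>\<i>h\<close>.\<close>
  have real: "Im (cinner h (S h)) = 0" for h
  proof -
    have "inner (blinfun_apply Y h) (\<i> *\<^sub>C h) = inner h (blinfun_apply Y (\<i> *\<^sub>C h))"
      by (rule symY)
    then have "Im (cinner (blinfun_apply Y h) h) = Im (cinner h (blinfun_apply Y h))"
      by (simp add: cY inner_eq_Re_cinner cinner_simps)
    moreover have "Im (cinner (blinfun_apply Y h) h) = - Im (cinner h (blinfun_apply Y h))"
      using cinner_commute[of "blinfun_apply Y h" h] by simp
    ultimately show ?thesis
      by (simp add: S_def cinner_simps cinner_self)
  qed
  have "positive_op S"
    using Sbc pos real by (auto simp: positive_op_iff inner_eq_Re_cinner)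
  moreover have "S (S x) = T x" for x
  proof -
    have "2 *\<^sub>R blinfun_apply Y x = x - (1/c) *\<^sub>R T x + blinfun_apply Y (blinfun_apply Y x)"
      using arg_cong[OF YY, of "\<lambda>A. blinfun_apply A x"] by (simp add: blinfun.bilinear_simps B)
    then have *: "(x - blinfun_apply Y x) - (blinfun_apply Y x - blinfun_apply Y (blinfun_apply Y x))
        = (1/c) *\<^sub>R T x"
      by (simp add: scaleR_2 algebra_simps)
    have "S (S x) = (sqrt c * sqrt c) *\<^sub>R ((x - blinfun_apply Y x)
        - (blinfun_apply Y x - blinfun_apply Y (blinfun_apply Y x)))"
      by (simp only: S_def blinfun.scaleR_right blinfun.diff_right scaleR_diff_right scaleR_scaleR)
    also note *
    finally have "S (S x) = (sqrt c * sqrt c) *\<^sub>R ((1/c) *\<^sub>R T x)" .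
    then show ?thesis
      using c by simp
  qed
  moreover have "Z (S x) = S (Z x)" if "bounded_linear Z" "\<And>x. Z (T x) = T (Z x)" for Z x
    using comm[OF that, of x] bounded_linear.linear[OF that(1)]
    by (simp add: S_def linear_diff linear_scale)
  ultimately show ?thesis
    by (rule that)
qed

text \<open>For \<open>y = S x - R x\<close>, commutation gives \<open>(S + R) y = S\<^sup>2 x - R\<^sup>2 x = 0\<close>, so that positivity forces
  \<open>S y = R y = 0\<close> and \<open>\<parallel>y\<parallel>\<^sup>2 = \<langle>x, (S - R) y\<rangle> = 0\<close>.\<close>

lemma positive_op_sqrt_unique:
  fixes S R :: "'a::complex_hilbert \<Rightarrow> 'a"
  assumes S: "positive_op S" and R: "positive_op R"
    and comm: "\<And>x. S (R x) = R (S x)" and eq: "\<And>x. S (S x) = R (R x)"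
  shows "S = R"
proof
  fix x
  define y where "y = S x - R x"
  have lin: "linear S" "linear R"
    using S R by (auto simp: positive_op_def bounded_clinear_def bounded_linear.linear)
  have "S y + R y = 0"
    using lin by (simp add: y_def linear_diff comm eq)
  then have "Re (cinner y (S y)) + Re (cinner y (R y)) = 0"
    by (metis cinner_add_right cinner.zero_right plus_complex.sel(1) zero_complex.sel(1))
  moreover have "0 \<le> Re (cinner y (S y))" "0 \<le> Re (cinner y (R y))"
    using S R by (auto simp: positive_op_iff)
  ultimately have "Re (cinner y (S y)) = 0" "Re (cinner y (R y)) = 0"
    by auto
  then have "S y = 0" "R y = 0"
    using positive_op_eq_0 S R by blast+
  then have "cinner (S x - R x) y = 0"
    using selfadjointD[OF positive_op_selfadjoint[OF S], of x y]
      selfadjointD[OF positive_op_selfadjoint[OF R], of x y]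
    by (simp add: cinner.diff_left)
  then show "S x = R x"
    by (simp add: y_def cinner_self)
qed

lemma op_sqrt_eqI:
  fixes S T :: "'a::complex_hilbert \<Rightarrow> 'a"
  assumes S: "positive_op S" and eq: "\<And>x. S (S x) = T x"
  shows "op_sqrt T = S"
proof -
  have bcS: "bounded_clinear S"
    using S by (rule positive_op_bc)
  have "cinner h (T h) = complex_of_real ((norm (S h))\<^sup>2)" for h
    using selfadjointD[OF positive_op_selfadjoint[OF S], of h "S h"] by (simp add: eq cinner_self)
  moreover have "bounded_clinear T"
    using bounded_clinear_compose[OF bcS bcS] by (simp add: eq)
  ultimately have T: "positive_op T"
    by (simp add: positive_op_iff)
  obtain R where R: "positive_op R" "\<And>x. R (R x) = T x"
    and comm: "\<And>Z x. bounded_linear Z \<Longrightarrow> (\<And>x. Z (T x) = T (Z x)) \<Longrightarrow> Z (R x) = R (Z x)"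
    using positive_op_sqrt_exists[OF T] by blast
  have uniq: "Q = R" if Q: "positive_op Q" "\<And>x. Q (Q x) = T x" for Q
  proof (rule positive_op_sqrt_unique[OF Q(1) R(1)])
    show "Q (R x) = R (Q x)" for x
      by (rule comm) (auto simp: bounded_clinear_bl positive_op_bc Q(1) simp flip: Q(2))
  qed (simp add: Q R)
  show ?thesis
    unfolding op_sqrt_def
  proof (rule the_equality)
    show "positive_op S \<and> S \<circ> S = T"
      using S eq by (auto simp: fun_eq_iff)
    show "Q = S" if "positive_op Q \<and> Q \<circ> Q = T" for Q
    proof -
      have "Q (Q x) = T x" for x
        using that by (metis comp_apply)
      then have "Q = R"
        using that by (intro uniq) auto
      also have "R = S"
        by (rule uniq[OF S eq, symmetric])
      finally show ?thesis .
    qed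
  qed
qed

lemma op_sqrt_positive:
  fixes T :: "'a::complex_hilbert \<Rightarrow> 'a"
  assumes T: "positive_op T"
  shows "positive_op (op_sqrt T)" and "op_sqrt T (op_sqrt T x) = T x"
proof -
  have "\<exists>S. positive_op S \<and> (\<forall>x. S (S x) = T x)"
  proof (rule positive_op_sqrt_exists[OF T])
    fix S assume "positive_op S" "\<And>x. S (S x) = T x"
    then show ?thesis
      by (intro exI[of _ S] conjI allI)
  qed
  then obtain S where S: "positive_op S" "\<And>x. S (S x) = T x"
    by blast
  then have eq: "op_sqrt T = S"
    by (rule op_sqrt_eqI)
  show "positive_op (op_sqrt T)" "op_sqrt T (op_sqrt T x) = T x"
    unfolding eq by (fact S)+
qed

lemma norm_op_sqrt_sq:
  fixes T :: "'a::complex_hilbert \<Rightarrow> 'a"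
  assumes "positive_op T"
  shows "(norm (op_sqrt T h))\<^sup>2 = Re (cinner h (T h))"
proof -
  have "cinner (op_sqrt T h) (op_sqrt T h) = cinner h (T h)"
    using selfadjointD[OF positive_op_selfadjoint[OF op_sqrt_positive(1)[OF assms]]]
    by (simp add: op_sqrt_positive(2)[OF assms])
  then show ?thesis
    using Re_cinner_self[of "op_sqrt T h"] by simp
qed

section \<open>Cylinders\<close>

lemma space_Omega: "space (Omega m) = {x. \<forall>i. x i < m}"
  by (auto simp: Omega_def space_PiM PiE_def)

lemma cylinder_Nil: "cylinder m [] = space (Omega m)"
  by (simp add: cylinder_def)

lemma cylinder_subset: "cylinder m w \<subseteq> space (Omega m)"
  by (auto simp: cylinder_def)

lemma cylinder_nonempty:
  assumes "w \<in> words m" and "m > 0"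
  obtains x where "x \<in> cylinder m w"
proof -
  have "(\<lambda>i. if i < length w then w ! i else 0) \<in> cylinder m w"
    using assms by (auto simp: cylinder_def space_Omega in_lists_conv_set)
  with that show ?thesis .
qed

lemma cylinder_snoc:
  "cylinder m (w @ [j]) = {x \<in> cylinder m w. x (length w) = j}"
  by (auto simp: cylinder_def nth_append less_Suc_eq)

lemma cylinder_split: "cylinder m w = (\<Union>j<m. cylinder m (w @ [j]))"
  by (auto simp: cylinder_snoc) (auto simp: cylinder_def space_Omega)

lemma cylinder_snoc_disjoint: "disjoint_family_on (\<lambda>j. cylinder m (w @ [j])) J"
  by (auto simp: disjoint_family_on_def cylinder_snoc)

text \<open>The sets that are determined by the first \<open>n\<close> letters.\<close>

definition level_set :: "nat \<Rightarrow> nat \<Rightarrow> (nat \<Rightarrow> nat) set \<Rightarrow> bool" where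
  "level_set m n A \<longleftrightarrow> A \<subseteq> space (Omega m) \<and>
     (\<forall>x\<in>space (Omega m). \<forall>y\<in>space (Omega m). (\<forall>i<n. x i = y i) \<longrightarrow> (x \<in> A \<longleftrightarrow> y \<in> A))"

lemma level_setD:
  assumes "level_set m n A" "x \<in> space (Omega m)" "y \<in> space (Omega m)" "\<And>i. i < n \<Longrightarrow> x i = y i"
  shows "x \<in> A \<longleftrightarrow> y \<in> A"
  using assms unfolding level_set_def by blast

text \<open>The words of length \<open>n\<close>; their cylinders are the atoms among the sets of level \<open>n\<close>.\<close>

definition level_words :: "nat \<Rightarrow> nat \<Rightarrow> nat list set" where
  "level_words m n = {w \<in> words m. length w = n}"

lemma finite_level_words: "finite (level_words m n)"
proof -
  have "level_words m n = {w. set w \<subseteq> {..<m} \<and> length w = n}"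
    by (auto simp: level_words_def)
  then show ?thesis
    by (simp add: finite_lists_length_eq)
qed

lemma level_set_mono: "level_set m n A \<Longrightarrow> n \<le> k \<Longrightarrow> level_set m k A"
  unfolding level_set_def by (meson order_less_le_trans)

lemma level_set_cylinder: "level_set m (length w) (cylinder m w)"
  by (auto simp: level_set_def cylinder_def)

lemma level_set_empty: "level_set m n {}"
  by (simp add: level_set_def)

lemma level_set_Un: "level_set m n A \<Longrightarrow> level_set m n B \<Longrightarrow> level_set m n (A \<union> B)"
  unfolding level_set_def by blast

lemma level_set_Diff: "level_set m n A \<Longrightarrow> level_set m n B \<Longrightarrow> level_set m n (A - B)"
  unfolding level_set_def by blast

lemma prefix_cylinder:
  assumes "x \<in> space (Omega m)"
  shows "map x [0..<n] \<in> level_words m n" and "x \<in> cylinder m (map x [0..<n])"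
  using assms by (auto simp: level_words_def cylinder_def space_Omega in_lists_conv_set)

lemma cylinder_level_cases:
  assumes "level_set m n A" "w \<in> level_words m n" "x \<in> cylinder m w" "x \<in> A"
  shows "cylinder m w \<subseteq> A"
proof
  fix y assume "y \<in> cylinder m w"
  then have "y \<in> space (Omega m)" "x \<in> space (Omega m)" "\<forall>i<n. x i = y i"
    using assms by (auto simp: cylinder_def level_words_def)
  then have "x \<in> A \<longleftrightarrow> y \<in> A"
    by (intro level_setD[OF assms(1)]) auto
  with assms(4) show "y \<in> A"
    by simp
qed

lemma level_set_Union:
  assumes "level_set m n A"
  shows "A = (\<Union>w\<in>{w \<in> level_words m n. cylinder m w \<subseteq> A}. cylinder m w)"
proof
  show "A \<subseteq> (\<Union>w\<in>{w \<in> level_words m n. cylinder m w \<subseteq> A}. cylinder m w)"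
  proof
    fix x assume x: "x \<in> A"
    then have sp: "x \<in> space (Omega m)"
      using assms by (auto simp: level_set_def)
    show "x \<in> (\<Union>w\<in>{w \<in> level_words m n. cylinder m w \<subseteq> A}. cylinder m w)"
      using prefix_cylinder[OF sp, of n]
        cylinder_level_cases[OF assms prefix_cylinder[OF sp] x] by blast
  qed
qed auto

lemma cylinder_sets: "cylinder m w \<in> sets (Omega m)"
proof (induction w rule: rev_induct)
  case Nil
  then show ?case
    by (simp add: cylinder_Nil)
next
  case (snoc j w)
  show ?case
  proof (cases "j < m")
    case True
    have "(\<lambda>x. x (length w)) -` {j} \<inter> space (Omega m) \<in> sets (Omega m)"
      unfolding Omega_def
      by (rule measurable_sets[OF measurable_component_singleton, where S="{j}"]) (use True in auto)
    moreover have "cylinder m (w @ [j]) = cylinder m w \<inter> ((\<lambda>x. x (length w)) -` {j} \<inter> space (Omega m))"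
      using cylinder_subset by (auto simp: cylinder_snoc)
    ultimately show ?thesis
      using snoc by simp
  next
    case False
    then have "cylinder m (w @ [j]) = {}"
      using cylinder_subset[of m w] by (auto simp: cylinder_snoc space_Omega)
    then show ?thesis
      by simp
  qed
qed

lemma level_set_sets:
  assumes "level_set m n A"
  shows "A \<in> sets (Omega m)"
proof -
  have "(\<Union>w\<in>{w \<in> level_words m n. cylinder m w \<subseteq> A}. cylinder m w) \<in> sets (Omega m)"
    by (intro sets.finite_UN finite_subset[OF _ finite_level_words] cylinder_sets) auto
  then show ?thesis
    using level_set_Union[OF assms] by simp
qed

text \<open>Besides the cylinders of words, the empty set is needed for stability under intersection.\<close>

definition cylinders :: "nat \<Rightarrow> (nat \<Rightarrow> nat) set set" where
  "cylinders m = insert {} (cylinder m ` words m)"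

lemma cylinder_Int:
  assumes "length w \<le> length v"
  shows "cylinder m w \<inter> cylinder m v = {} \<or> cylinder m w \<inter> cylinder m v = cylinder m v"
proof (cases "take (length w) v = w")
  case True
  have "v ! i = w ! i" if "i < length w" for i
    using True that nth_take by metis
  then show ?thesis
    using assms by (auto simp: cylinder_def)
next
  case False
  then obtain i where i: "i < length w" "v ! i \<noteq> w ! i"
    using assms by (metis length_take min.absorb2 nth_equalityI nth_take)
  then show ?thesis
    using assms by (auto simp: cylinder_def)
qed

lemma Int_stable_cylinders: "Int_stable (cylinders m)"
proof (rule Int_stableI)
  fix a b assume "a \<in> cylinders m" "b \<in> cylinders m"
  then consider "a = {} \<or> b = {}"
    | w v where "a = cylinder m w" "b = cylinder m v" "w \<in> words m" "v \<in> words m"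
    by (auto simp: cylinders_def)
  then show "a \<inter> b \<in> cylinders m"
  proof cases
    case 2
    then show ?thesis
      using cylinder_Int[of w v m] cylinder_Int[of v w m]
      by (cases "length w \<le> length v") (auto simp: cylinders_def Int_commute)
  qed (auto simp: cylinders_def)
qed

lemma sets_Omega: "sets (Omega m) = sigma_sets (space (Omega m)) (cylinders m)"
proof
  let ?S = "sigma_sets (space (Omega m)) (cylinders m)"
  interpret S: sigma_algebra "space (Omega m)" ?S
    by (rule sigma_algebra_sigma_sets) (auto simp: cylinders_def cylinder_def)
  show "?S \<subseteq> sets (Omega m)"
    by (rule sets.sigma_sets_subset) (auto simp: cylinders_def cylinder_sets)
  have "{f \<in> space (Omega m). f i \<in> A} \<in> ?S" for i and A :: "nat set"
  proof -
    have l: "level_set m (Suc i) {f \<in> space (Omega m). f i \<in> A}"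
      by (auto simp: level_set_def)
    have "(\<Union>w\<in>{w \<in> level_words m (Suc i). cylinder m w \<subseteq> {f \<in> space (Omega m). f i \<in> A}}. cylinder m w) \<in> ?S"
      by (intro S.finite_UN finite_subset[OF _ finite_level_words])
        (auto simp: cylinders_def level_words_def)
    then show ?thesis
      using level_set_Union[OF l] by simp
  qed
  then have "{{f \<in> space (Omega m). f i \<in> A} | i A. i \<in> UNIV \<and> A \<in> sets (count_space {..<m})} \<subseteq> ?S"
    by blast
  then have "sigma_sets (space (Omega m))
      {{f \<in> space (Omega m). f i \<in> A} | i A. i \<in> UNIV \<and> A \<in> sets (count_space {..<m})} \<subseteq> ?S"
    by (rule S.sigma_sets_subset)
  then show "sets (Omega m) \<subseteq> ?S"
    using sets_PiM_single[of "UNIV :: nat set" "\<lambda>_. count_space {..<m}"]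
    by (simp add: Omega_def space_PiM)
qed

section \<open>Countably additive functions on the sequence space\<close>

text \<open>Complex measures, as functions on all sets whose values outside the sigma-algebra are
  irrelevant. The matrix entries of a POVM have this form.\<close>

definition csigma_additive :: "nat \<Rightarrow> ((nat \<Rightarrow> nat) set \<Rightarrow> complex) \<Rightarrow> bool" where
  "csigma_additive m \<phi> \<longleftrightarrow> (\<forall>A. range A \<subseteq> sets (Omega m) \<longrightarrow> disjoint_family A \<longrightarrow>
     (\<lambda>n::nat. \<phi> (A n)) sums \<phi> (\<Union>n. A n))"

lemma csigma_additive_empty: "csigma_additive m \<phi> \<Longrightarrow> \<phi> {} = 0"
proof -
  assume "csigma_additive m \<phi>"
  then have "(\<lambda>n::nat. \<phi> {}) sums \<phi> (\<Union>n::nat. {})"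
    unfolding csigma_additive_def
    by (elim allE[of _ "\<lambda>_. {}"]) (auto simp: disjoint_family_on_def)
  then have "(\<lambda>n::nat. \<phi> {}) \<longlonglongrightarrow> 0"
    by (intro summable_LIMSEQ_zero) (auto simp: sums_iff)
  then show ?thesis
    by (simp add: LIMSEQ_const_iff)
qed

lemma csigma_additive_Un:
  assumes \<phi>: "csigma_additive m \<phi>" and A: "A \<in> sets (Omega m)" "B \<in> sets (Omega m)" "A \<inter> B = {}"
  shows "\<phi> (A \<union> B) = \<phi> A + \<phi> B"
proof -
  have "range (binaryset A B) \<subseteq> sets (Omega m)" "disjoint_family (binaryset A B)"
    using A by (auto simp: binaryset_def disjoint_family_on_def)
  then have "(\<lambda>n. \<phi> (binaryset A B n)) sums \<phi> (\<Union>n. binaryset A B n)"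
    using \<phi> unfolding csigma_additive_def by blast
  then have "(\<lambda>n. \<phi> (binaryset A B n)) sums \<phi> (A \<union> B)"
    by (simp only: UN_binaryset_eq)
  moreover have "(\<lambda>n. \<phi> (binaryset A B n)) sums (\<phi> A + \<phi> B)"
    using csigma_additive_empty[OF \<phi>] by (intro binaryset_sums)
  ultimately show ?thesis
    using sums_unique2 by blast
qed

lemma csigma_additive_finite_Union:
  assumes \<phi>: "csigma_additive m \<phi>" and I: "finite I" "\<And>i. i \<in> I \<Longrightarrow> A i \<in> sets (Omega m)"
    "disjoint_family_on A I"
  shows "\<phi> (\<Union>i\<in>I. A i) = (\<Sum>i\<in>I. \<phi> (A i))"
  using I
proof (induction I rule: finite_induct)
  case (insert i I)
  have "A i \<inter> (\<Union>j\<in>I. A j) = {}"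
    using insert by (auto simp: disjoint_family_on_def)
  moreover have "(\<Union>j\<in>I. A j) \<in> sets (Omega m)"
    using insert by (intro sets.finite_UN) auto
  moreover have "disjoint_family_on A I"
    using insert.prems by (auto simp: disjoint_family_on_def)
  ultimately show ?case
    using insert by (simp add: csigma_additive_Un[OF \<phi>])
qed (simp add: csigma_additive_empty[OF \<phi>])

lemma csigma_additive_add:
  "csigma_additive m \<phi> \<Longrightarrow> csigma_additive m \<psi> \<Longrightarrow> csigma_additive m (\<lambda>A. \<phi> A + \<psi> A)"
  unfolding csigma_additive_def by (auto intro!: sums_add)

lemma csigma_additive_diff:
  "csigma_additive m \<phi> \<Longrightarrow> csigma_additive m \<psi> \<Longrightarrow> csigma_additive m (\<lambda>A. \<phi> A - \<psi> A)"
  unfolding csigma_additive_def by (auto intro!: sums_diff)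

lemma csigma_additive_mult:
  "csigma_additive m \<phi> \<Longrightarrow> csigma_additive m (\<lambda>A. c * \<phi> A)"
  unfolding csigma_additive_def by (auto intro!: sums_mult)

text \<open>By Dynkin's theorem for the intersection-stable generator of cylinders.\<close>

lemma csigma_additive_zero:
  assumes \<phi>: "csigma_additive m \<phi>" and zero: "\<And>w. w \<in> words m \<Longrightarrow> \<phi> (cylinder m w) = 0"
    and A: "A \<in> sets (Omega m)"
  shows "\<phi> A = 0"
proof -
  have "cylinders m \<subseteq> Pow (space (Omega m))"
    by (auto simp: cylinders_def cylinder_def)
  from Int_stable_cylinders[of m] this A[unfolded sets_Omega] show ?thesis
  proof (induction A rule: sigma_sets_induct_disjoint)
    case (basic A)
    then show ?case
      using zero csigma_additive_empty[OF \<phi>] by (auto simp: cylinders_def)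
  next
    case empty
    then show ?case
      by (rule csigma_additive_empty[OF \<phi>])
  next
    case (compl A)
    have "\<phi> (space (Omega m)) = 0"
      using zero[of "[]"] by (simp add: cylinder_Nil)
    moreover have "A \<union> (space (Omega m) - A) = space (Omega m)"
      using compl sets.sets_into_space by (fastforce simp: sets_Omega[symmetric])
    ultimately show ?case
      using csigma_additive_Un[OF \<phi>, of A "space (Omega m) - A"] compl
      by (simp add: sets_Omega[symmetric] sets.compl_sets)
  next
    case (union A)
    have "(\<lambda>n. \<phi> (A n)) sums \<phi> (\<Union>n. A n)"
      using \<phi> union(1,2) unfolding csigma_additive_def sets_Omega by blast
    then have "(\<lambda>n. 0) sums \<phi> (\<Union>n. A n)"
      using union(3) by simp
    then show ?case
      by (rule sums_unique2) (rule sums_zero)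
  qed
qed

lemma csigma_additive_eq:
  assumes "csigma_additive m \<phi>" "csigma_additive m \<psi>"
    and "\<And>w. w \<in> words m \<Longrightarrow> \<phi> (cylinder m w) = \<psi> (cylinder m w)"
    and "A \<in> sets (Omega m)"
  shows "\<phi> A = \<psi> A"
  using csigma_additive_zero[OF csigma_additive_diff[OF assms(1,2)] _ assms(4)] assms(3) by simp

lemma csigma_additive_measure:
  assumes "finite_measure M" "sets M = sets (Omega m)"
  shows "csigma_additive m (\<lambda>A. complex_of_real (measure M A))"
  unfolding csigma_additive_def
  using assms by (auto simp: sums_of_real_iff intro!: finite_measure.finite_measure_UNION)

lemma csigma_additive_cylinder:
  assumes "csigma_additive m \<phi>"
  shows "\<phi> (cylinder m w) = (\<Sum>j<m. \<phi> (cylinder m (w @ [j])))"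
  by (subst cylinder_split, rule csigma_additive_finite_Union[OF assms])
    (auto intro: cylinder_sets cylinder_snoc_disjoint)

lemma finite_measure_of_csigma_additive:
  assumes \<phi>: "csigma_additive m \<phi>" and pos: "\<And>A. A \<in> sets (Omega m) \<Longrightarrow> \<phi> A = complex_of_real (r A) \<and> 0 \<le> r A"
  obtains M where "finite_measure M" "sets M = sets (Omega m)"
    "\<And>A. A \<in> sets (Omega m) \<Longrightarrow> measure M A = r A"
proof -
  define M where "M = measure_of (space (Omega m)) (sets (Omega m)) (\<lambda>A. ennreal (r A))"
  have sM: "sets M = sets (Omega m)" "space M = space (Omega m)"
    by (auto simp: M_def)
  have eM: "emeasure M A = ennreal (r A)" if A: "A \<in> sets (Omega m)" for A
    unfolding M_def
  proof (rule emeasure_measure_of_sigma[OF sets.sigma_algebra_axioms _ _ A])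
    show "positive (sets (Omega m)) (\<lambda>A. ennreal (r A))"
      using csigma_additive_empty[OF \<phi>] pos[of "{}"] by (simp add: positive_def)
    show "countably_additive (sets (Omega m)) (\<lambda>A. ennreal (r A))"
    proof (rule countably_additiveI)
      fix A :: "nat \<Rightarrow> _" assume A: "range A \<subseteq> sets (Omega m)" "disjoint_family A" "\<Union>(range A) \<in> sets (Omega m)"
      then have "(\<lambda>n. \<phi> (A n)) sums \<phi> (\<Union>n. A n)"
        using \<phi> by (simp add: csigma_additive_def)
      then have "(\<lambda>n. complex_of_real (r (A n))) sums complex_of_real (r (\<Union>n. A n))"
        using A pos by (simp add: range_subsetD)
      then have "(\<lambda>n. r (A n)) sums r (\<Union>n. A n)"
        by (simp add: sums_of_real_iff)
      then show "(\<Sum>i. ennreal (r (A i))) = ennreal (r (\<Union>(range A)))"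
        using A pos by (intro suminf_ennreal_eq) (auto simp: range_subsetD)
    qed
  qed
  have "finite_measure M"
    by (rule finite_measureI) (simp add: sM eM)
  moreover have "measure M A = r A" if "A \<in> sets (Omega m)" for A
    using eM[OF that] pos[OF that] by (simp add: measure_def)
  ultimately show ?thesis
    using sM by (intro that)
qed

subsection \<open>Extension of dominated cylinder functions\<close>

text \<open>The value on a set of level \<open>n\<close> that finite additivity prescribes. For additive \<open>g\<close> it does
  not depend on the level at which the set is seen.\<close>

definition cylinder_content :: "nat \<Rightarrow> (nat list \<Rightarrow> real) \<Rightarrow> nat \<Rightarrow> (nat \<Rightarrow> nat) set \<Rightarrow> real" where
  "cylinder_content m g n A = (\<Sum>w\<in>{w \<in> level_words m n. cylinder m w \<subseteq> A}. g w)"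

lemma level_words_Suc:
  "level_words m (Suc n) = (\<lambda>(w, j). w @ [j]) ` (level_words m n \<times> {..<m})"
proof (intro equalityI subsetI)
  fix v assume v: "v \<in> level_words m (Suc n)"
  then obtain w j where "v = w @ [j]"
    by (metis (mono_tags, lifting) level_words_def length_0_conv mem_Collect_eq nat.distinct(1) rev_exhaust)
  with v show "v \<in> (\<lambda>(w, j). w @ [j]) ` (level_words m n \<times> {..<m})"
    by (auto simp: level_words_def)
qed (auto simp: level_words_def)

lemma cylinder_content_Suc:
  assumes m: "m > 0" and g: "\<And>w. w \<in> words m \<Longrightarrow> g w = (\<Sum>j<m. g (w @ [j]))"
    and A: "level_set m n A"
  shows "cylinder_content m g (Suc n) A = cylinder_content m g n A"
proof -
  let ?W = "{w \<in> level_words m n. cylinder m w \<subseteq> A}"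
  have iff: "cylinder m (w @ [j]) \<subseteq> A \<longleftrightarrow> cylinder m w \<subseteq> A" if w: "w \<in> level_words m n" "j < m" for w j
  proof
    assume s: "cylinder m (w @ [j]) \<subseteq> A"
    have "w @ [j] \<in> words m"
      using w by (auto simp: level_words_def)
    then obtain x where "x \<in> cylinder m (w @ [j])"
      using cylinder_nonempty m by blast
    then have "x \<in> cylinder m w" "x \<in> A"
      using s by (auto simp: cylinder_snoc)
    then show "cylinder m w \<subseteq> A"
      using cylinder_level_cases[OF A w(1)] by blast
  qed (auto simp: cylinder_snoc)
  then have W: "{v \<in> level_words m (Suc n). cylinder m v \<subseteq> A} = (\<lambda>(w, j). w @ [j]) ` (?W \<times> {..<m})"
    unfolding level_words_Suc by force
  then have "cylinder_content m g (Suc n) A = (\<Sum>(w, j)\<in>?W \<times> {..<m}. g (w @ [j]))"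
    unfolding cylinder_content_def W by (subst sum.reindex) (auto simp: inj_on_def case_prod_unfold)
  also have "\<dots> = (\<Sum>w\<in>?W. \<Sum>j<m. g (w @ [j]))"
    by (simp add: sum.cartesian_product)
  also have "\<dots> = cylinder_content m g n A"
    unfolding cylinder_content_def by (intro sum.cong refl g[symmetric]) (auto simp: level_words_def)
  finally show ?thesis .
qed

lemma cylinder_content_level:
  assumes m: "m > 0" and g: "\<And>w. w \<in> words m \<Longrightarrow> g w = (\<Sum>j<m. g (w @ [j]))"
    and A: "level_set m n A" and nk: "n \<le> k"
  shows "cylinder_content m g k A = cylinder_content m g n A"
  using nk
proof (induction k rule: dec_induct)
  case (step k)
  then show ?case
    using cylinder_content_Suc[OF m g level_set_mono[OF A]] by simp
qed simp

lemma cylinder_content_Un: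
  assumes m: "m > 0" and A: "level_set m n A" and B: "level_set m n B" and AB: "A \<inter> B = {}"
  shows "cylinder_content m g n (A \<union> B) = cylinder_content m g n A + cylinder_content m g n B"
proof -
  have ne: "cylinder m w \<noteq> {}" if "w \<in> level_words m n" for w
    using that cylinder_nonempty[OF _ m, of w] by (auto simp: level_words_def)
  have "{w \<in> level_words m n. cylinder m w \<subseteq> A \<union> B}
      = {w \<in> level_words m n. cylinder m w \<subseteq> A} \<union> {w \<in> level_words m n. cylinder m w \<subseteq> B}"
    using ne cylinder_level_cases[OF A] cylinder_level_cases[OF B] by blast
  moreover have "{w \<in> level_words m n. cylinder m w \<subseteq> A} \<inter> {w \<in> level_words m n. cylinder m w \<subseteq> B} = {}"
    using ne AB by blast
  ultimately show ?thesis
    unfolding cylinder_content_def using finite_level_words[of m n] by (simp add: sum.union_disjoint)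
qed

lemma cylinder_disjoint:
  assumes "w \<in> level_words m n" "v \<in> level_words m n" "w \<noteq> v"
  shows "cylinder m w \<inter> cylinder m v = {}"
proof -
  obtain i where "i < n" "w ! i \<noteq> v ! i"
    using assms by (metis (mono_tags, lifting) level_words_def mem_Collect_eq nth_equalityI)
  then show ?thesis
    using assms by (auto simp: cylinder_def level_words_def)
qed

lemma cylinder_content_measure:
  assumes e: "finite_measure e" "sets e = sets (Omega m)" and A: "level_set m n A"
  shows "cylinder_content m (\<lambda>w. measure e (cylinder m w)) n A = measure e A"
proof -
  have "measure e (\<Union>w\<in>{w \<in> level_words m n. cylinder m w \<subseteq> A}. cylinder m w)
      = cylinder_content m (\<lambda>w. measure e (cylinder m w)) n A"
    unfolding cylinder_content_def
  proof (rule finite_measure.finite_measure_finite_Union[OF e(1)])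
    show "disjoint_family_on (cylinder m) {w \<in> level_words m n. cylinder m w \<subseteq> A}"
      unfolding disjoint_family_on_def using cylinder_disjoint by blast
  qed (auto simp: finite_level_words e(2) cylinder_sets)
  then show ?thesis
    using level_set_Union[OF A] by simp
qed

text \<open>An additive function of words, dominated by a finite measure on cylinders, extends to a
  measure. The dominating measure supplies continuity at the empty set, so that compactness of the
  sequence space is not needed.\<close>

lemma dominated_cylinder_extension:
  assumes m: "m > 0" and e: "finite_measure e" "sets e = sets (Omega m)"
    and g: "\<And>w. w \<in> words m \<Longrightarrow> g w = (\<Sum>j<m. g (w @ [j]))"
    and g0: "\<And>w. w \<in> words m \<Longrightarrow> 0 \<le> g w"
    and ge: "\<And>w. w \<in> words m \<Longrightarrow> g w \<le> measure e (cylinder m w)"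
  obtains M where "finite_measure M" "sets M = sets (Omega m)"
    "\<And>w. w \<in> words m \<Longrightarrow> measure M (cylinder m w) = g w"
proof -
  define \<A> where "\<A> = {A. \<exists>n. level_set m n A}"
  define f where "f A = ennreal (cylinder_content m g (LEAST n. level_set m n A) A)" for A
  have f: "f A = ennreal (cylinder_content m g n A)" if A: "level_set m n A" for n A
  proof -
    have L: "level_set m (LEAST n. level_set m n A) A" "(LEAST n. level_set m n A) \<le> n"
      using A by (auto intro: LeastI Least_le)
    have "cylinder_content m g n A = cylinder_content m g (LEAST n. level_set m n A) A"
      by (rule cylinder_content_level[OF m _ L]) (rule g)
    then show ?thesis
      by (simp only: f_def)
  qed
  have c0: "0 \<le> cylinder_content m g n A" for n A
    unfolding cylinder_content_def by (rule sum_nonneg) (auto simp: level_words_def g0)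
  have ce: "cylinder_content m g n A \<le> measure e A" if A: "level_set m n A" for n A
    unfolding cylinder_content_measure[OF e A, symmetric] cylinder_content_def
    by (rule sum_mono) (auto simp: level_words_def ge)
  have common: "\<exists>n. level_set m n A \<and> level_set m n B" if AB: "A \<in> \<A>" "B \<in> \<A>" for A B
  proof -
    obtain n k where "level_set m n A" "level_set m k B"
      using AB by (auto simp: \<A>_def)
    then show ?thesis
      using level_set_mono[of m n A "max n k"] level_set_mono[of m k B "max n k"] by auto
  qed
  interpret ring_of_sets "space (Omega m)" \<A>
  proof (unfold ring_of_sets_iff, intro conjI ballI)
    show "\<A> \<subseteq> Pow (space (Omega m))"
      by (auto simp: \<A>_def level_set_def)
    show "{} \<in> \<A>"
      by (auto simp: \<A>_def level_set_def)
    fix A B assume "A \<in> \<A>" "B \<in> \<A>"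
    then show "A \<union> B \<in> \<A>" "A - B \<in> \<A>"
      using common level_set_Un level_set_Diff unfolding \<A>_def by blast+
  qed
  have "\<exists>\<mu>. (\<forall>A\<in>\<A>. \<mu> A = f A) \<and> measure_space (space (Omega m)) (sigma_sets (space (Omega m)) \<A>) \<mu>"
  proof (rule caratheodory_empty_continuous)
    have l: "level_set m 0 {}"
      by (auto simp: level_set_def)
    have "cylinder_content m g 0 {} = 0"
      using ce[OF l] c0[of 0 "{}"] by simp
    then show "positive \<A> f"
      by (simp add: positive_def f[OF l])
    show "additive \<A> f"
      unfolding additive_def
    proof (intro ballI impI)
      fix A B assume AB: "A \<in> \<A>" "B \<in> \<A>" "A \<inter> B = {}"
      then obtain n where n: "level_set m n A" "level_set m n B"
        using common by blast
      show "f (A \<union> B) = f A + f B"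
        using n AB(3) by (simp add: f[OF n(1)] f[OF n(2)] f[OF level_set_Un[OF n]] cylinder_content_Un[OF m] c0)
    qed
    show "f A \<noteq> \<infinity>" for A
      by (simp add: f_def)
    fix A :: "nat \<Rightarrow> _" assume A: "range A \<subseteq> \<A>" "decseq A" "(\<Inter>i. A i) = {}"
    have le: "f (A i) \<le> ennreal (measure e (A i))" and si: "A i \<in> sets e" for i
    proof -
      obtain n where "level_set m n (A i)"
        using A(1) by (auto simp: \<A>_def)
      then show "f (A i) \<le> ennreal (measure e (A i))" "A i \<in> sets e"
        using ce e(2) level_set_sets by (auto simp: f intro!: ennreal_leI)
    qed
    have "(\<lambda>i. measure e (A i)) \<longlonglongrightarrow> measure e (\<Inter>i. A i)"
      using si A(2) by (intro finite_measure.finite_Lim_measure_decseq[OF e(1)]) auto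
    then have "(\<lambda>i. ennreal (measure e (A i))) \<longlonglongrightarrow> ennreal 0"
      unfolding A(3) by (intro tendsto_ennrealI) simp
    then have lim: "(\<lambda>i. ennreal (measure e (A i))) \<longlonglongrightarrow> 0"
      by simp
    show "(\<lambda>i. f (A i)) \<longlonglongrightarrow> 0"
      by (rule tendsto_sandwich[OF _ _ tendsto_const lim]) (simp_all add: le)
  qed
  then obtain \<mu> where \<mu>: "\<And>A. A \<in> \<A> \<Longrightarrow> \<mu> A = f A"
    and ms: "measure_space (space (Omega m)) (sigma_sets (space (Omega m)) \<A>) \<mu>"
    by blast
  have sig: "sigma_sets (space (Omega m)) \<A> = sets (Omega m)"
  proof
    show "sigma_sets (space (Omega m)) \<A> \<subseteq> sets (Omega m)"
      by (rule sets.sigma_sets_subset) (auto simp: \<A>_def level_set_sets)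
    have "cylinders m \<subseteq> \<A>"
      unfolding cylinders_def \<A>_def using level_set_cylinder level_set_empty by blast
    then show "sets (Omega m) \<subseteq> sigma_sets (space (Omega m)) \<A>"
      unfolding sets_Omega by (rule sigma_sets_mono')
  qed
  define M where "M = measure_of (space (Omega m)) (sets (Omega m)) \<mu>"
  have sM: "sets M = sets (Omega m)" "space M = space (Omega m)"
    by (auto simp: M_def)
  have eM: "emeasure M A = \<mu> A" if "A \<in> sets (Omega m)" for A
    unfolding M_def using ms that sig
    by (intro emeasure_measure_of_sigma) (auto simp: measure_space_def)
  have cyl: "emeasure M (cylinder m w) = ennreal (g w)" if w: "w \<in> words m" for w
  proof -
    have "level_words m (length w) \<inter> {v. cylinder m v \<subseteq> cylinder m w} = {w}"
    proof (intro equalityI subsetI)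
      fix v assume v: "v \<in> level_words m (length w) \<inter> {v. cylinder m v \<subseteq> cylinder m w}"
      then obtain x where "x \<in> cylinder m v"
        using cylinder_nonempty[OF _ m, of v] by (auto simp: level_words_def)
      with v w show "v \<in> {w}"
        using cylinder_disjoint[of v m "length w" w] by (auto simp: level_words_def)
    qed (use w in \<open>auto simp: level_words_def\<close>)
    then have "cylinder_content m g (length w) (cylinder m w) = g w"
      by (simp add: cylinder_content_def Int_def)
    moreover have "cylinder m w \<in> \<A>"
      using level_set_cylinder by (auto simp: \<A>_def)
    ultimately show ?thesis
      by (simp add: eM cylinder_sets \<mu> f[OF level_set_cylinder])
  qed
  have "emeasure M (space M) \<noteq> \<infinity>"
    using cyl[of "[]"] by (simp add: sM cylinder_Nil)
  then have fin: "finite_measure M"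
    by (rule finite_measureI)
  have "measure M (cylinder m w) = g w" if "w \<in> words m" for w
    using cyl[OF that] g0[OF that] by (simp add: measure_def)
  with fin sM show ?thesis
    by (intro that)
qed

text \<open>The difference of the two measures is nonnegative on cylinders, so it extends from there to a
  measure, which by uniqueness is the difference on all sets.\<close>

lemma measure_le_of_cylinders:
  assumes m: "m > 0" and M: "finite_measure M" "sets M = sets (Omega m)"
    and N: "finite_measure N" "sets N = sets (Omega m)"
    and le: "\<And>w. w \<in> words m \<Longrightarrow> measure M (cylinder m w) \<le> measure N (cylinder m w)"
    and A: "A \<in> sets (Omega m)"
  shows "measure M A \<le> measure N A"
proof -
  have add: "measure K (cylinder m w) = (\<Sum>j<m. measure K (cylinder m (w @ [j])))"
    if "finite_measure K" "sets K = sets (Omega m)" for K w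
    using csigma_additive_cylinder[OF csigma_additive_measure[OF that], of w]
    by (simp flip: of_real_sum)
  obtain D where D: "finite_measure D" "sets D = sets (Omega m)"
    and Dw: "\<And>w. w \<in> words m \<Longrightarrow> measure D (cylinder m w)
      = measure N (cylinder m w) - measure M (cylinder m w)"
  proof (rule dominated_cylinder_extension[OF m N, of "\<lambda>w. measure N (cylinder m w) - measure M (cylinder m w)"])
    show "measure N (cylinder m w) - measure M (cylinder m w)
        = (\<Sum>j<m. measure N (cylinder m (w @ [j])) - measure M (cylinder m (w @ [j])))" for w
      unfolding add[OF M, of w] add[OF N, of w] by (simp add: sum_subtractf)
  qed (use le in auto)
  have "complex_of_real (measure M A) + complex_of_real (measure D A) = complex_of_real (measure N A)"
    by (rule csigma_additive_eq[OF csigma_additive_add[OF csigma_additive_measure[OF M] csigma_additive_measure[OF D]]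
          csigma_additive_measure[OF N] _ A]) (simp add: Dw)
  then have "measure M A + measure D A = measure N A"
    by (metis of_real_add of_real_eq_iff)
  then show ?thesis
    using measure_nonneg[of D A] by linarith
qed

section \<open>Sandwiched operators\<close>

lemma norm_cadjoint_le:
  fixes T :: "'a::complex_hilbert \<Rightarrow> 'a"
  assumes T: "bounded_clinear T" and c: "c \<ge> 0" "\<And>x. norm (T x) \<le> c * norm x"
  shows "norm (cadjoint T x) \<le> c * norm x"
proof -
  let ?u = "cadjoint T x"
  have "norm ?u * norm ?u = norm (cinner ?u ?u)"
    by (simp only: norm_cinner_self power2_eq_square)
  also have "\<dots> = norm (cinner x (T ?u))"
    by (simp only: cadjoint_exists(2)[OF T])
  also have "\<dots> \<le> norm x * norm (T ?u)"
    by (rule cinner_norm_le)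
  also have "\<dots> \<le> norm x * (c * norm ?u)"
    by (intro mult_left_mono c) auto
  finally have "norm ?u * norm ?u \<le> norm ?u * (c * norm x)"
    by (simp add: mult_ac)
  then show ?thesis
    using c(1) by (cases "norm ?u = 0") auto
qed

lemma cadjoint_bops:
  fixes T :: "'a::complex_hilbert \<Rightarrow> 'a"
  assumes T: "T \<in> bops K L" and K: "csubspace K" "closed K"
  shows "cadjoint T \<in> bops L K"
proof -
  have bc: "bounded_clinear T" and ran: "\<And>x. T x \<in> L" and zero: "\<And>x. x \<in> orth_compl K \<Longrightarrow> T x = 0"
    using T by (auto simp: bops_def)
  note adj = cadjoint_exists[OF bc]
  have "cadjoint T x \<in> K" for x
  proof (rule orth_compl_orth_compl_subset[OF K])
    fix y assume "y \<in> orth_compl K"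
    then have "cinner (cadjoint T x) y = 0"
      by (simp add: adj(2) zero)
    then show "cinner y (cadjoint T x) = 0"
      using cinner_commute[of y "cadjoint T x"] by simp
  qed
  moreover have "cadjoint T x = 0" if x: "x \<in> orth_compl L" for x
  proof (rule cinner_eqI_left)
    fix y
    have "cinner (T y) x = 0"
      using x ran by (simp add: orth_compl_def)
    then show "cinner (cadjoint T x) y = cinner 0 y"
      using cinner_commute[of x "T y"] by (simp add: adj(2))
  qed
  ultimately show ?thesis
    using adj(1) by (auto simp: bops_def)
qed

text \<open>An operator dominated by a multiple of \<open>S\<^sup>2\<close> has the form \<open>S X S\<close>: the root of the operator
  factors as \<open>D S\<close>, and \<open>X = D\<^sup>* D\<close>.\<close>

lemma sandwich_exists:
  fixes S T :: "'a::complex_hilbert \<Rightarrow> 'a"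
  assumes S: "positive_op S" and T: "positive_op T" and b: "b \<ge> 0"
    and le: "\<And>h. Re (cinner h (T h)) \<le> b * (norm (S h))\<^sup>2"
  obtains X where "X \<in> bops (closure (range S)) (closure (range S))" "selfadjoint X"
    "\<And>x. norm (X x) \<le> b * norm x" "\<And>h. S (X (S h)) = T h"
proof -
  let ?K = "closure (range S)"
  define R where "R = op_sqrt T"
  have R: "positive_op R" "\<And>x. R (R x) = T x"
    unfolding R_def by (fact op_sqrt_positive[OF T])+
  note sS = selfadjointD[OF positive_op_selfadjoint[OF S]]
  note sR = selfadjointD[OF positive_op_selfadjoint[OF R(1)]]
  have K: "csubspace ?K" "closed ?K"
    by (auto intro: csubspace_closure csubspace_range positive_op_bc S)
  have nR: "norm (R h) \<le> sqrt b * norm (S h)" for h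
  proof (rule power2_le_imp_le)
    show "(norm (R h))\<^sup>2 \<le> (sqrt b * norm (S h))\<^sup>2"
      using le[of h] b by (simp add: R_def norm_op_sqrt_sq[OF T] power_mult_distrib)
  qed (simp add: b)
  obtain D where D: "D \<in> bops ?K (closure (range R))" "\<And>h. D (S h) = R h"
    "\<And>x. norm (D x) \<le> sqrt b * norm x"
    using douglas[OF positive_op_bc[OF S] positive_op_bc[OF R(1)] _ nR] b by auto
  have bcD: "bounded_clinear D"
    using D(1) by (simp add: bops_def)
  note adj = cadjoint_exists[OF bcD]
  define X where "X x = cadjoint D (D x)" for x
  have aD: "cadjoint D \<in> bops (closure (range R)) ?K"
    by (rule cadjoint_bops[OF D(1) K])
  have a0: "cadjoint D 0 = 0"
    using adj(1) by (simp add: bounded_clinear_def bounded_linear.linear linear_0)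
  show ?thesis
  proof (rule that)
    show "X \<in> bops ?K ?K"
      using D(1) aD bounded_clinear_compose[OF adj(1) bcD] a0
      by (auto simp: bops_def X_def[abs_def])
    show "selfadjoint X"
      unfolding selfadjoint_def X_def
    proof (intro allI)
      fix x y
      show "cinner (cadjoint D (D x)) y = cinner x (cadjoint D (D y))"
        using adj(2)[of "D x" y] adj(2)[of "D y" x]
          cinner_commute[of x "cadjoint D (D y)"] cinner_commute[of "D x" "D y"] by simp
    qed
    show "norm (X x) \<le> b * norm x" for x
    proof -
      have "norm (X x) \<le> sqrt b * norm (D x)"
        unfolding X_def by (rule norm_cadjoint_le[OF bcD _ D(3)]) (simp add: b)
      also have "\<dots> \<le> sqrt b * (sqrt b * norm x)"
        by (intro mult_left_mono D(3)) (simp add: b)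
      also have "\<dots> = (sqrt b * sqrt b) * norm x"
        by (simp only: mult.assoc)
      finally show ?thesis
        using b by simp
    qed
    show "S (X (S h)) = T h" for h
    proof (rule cinner_eqI_left)
      fix y
      have "cinner (S (X (S h))) y = cinner (cadjoint D (D (S h))) (S y)"
        by (simp add: sS X_def)
      also have "\<dots> = cinner (R h) (R y)"
        by (simp add: adj(2) D(2))
      also have "\<dots> = cinner (R (R h)) y"
        by (rule sR[symmetric])
      finally show "cinner (S (X (S h))) y = cinner (T h) y"
        by (simp add: R(2))
    qed
  qed
qed

lemma sandwich_inj:
  fixes S :: "'a::complex_hilbert \<Rightarrow> 'a"
  assumes S: "positive_op S" and X: "X \<in> bops (closure (range S)) (closure (range S))"
    "X' \<in> bops (closure (range S)) (closure (range S))"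
    and eq: "\<And>h. S (X (S h)) = S (X' (S h))"
  shows "X = X'"
proof (rule bops_eqI_range[OF positive_op_bc[OF S] X])
  fix h
  let ?v = "X (S h) - X' (S h)"
  have "csubspace (closure (range S))"
    by (intro csubspace_closure csubspace_range positive_op_bc S)
  then have v: "?v \<in> closure (range S)"
    using X by (auto simp: csubspace_def bops_def intro!: subspace_diff)
  have "linear S"
    using positive_op_bc[OF S] by (simp add: bounded_clinear_def bounded_linear.linear)
  then have "S ?v = 0"
    by (simp add: linear_diff eq)
  then have "cinner ?v (S k) = 0" for k
    using selfadjointD[OF positive_op_selfadjoint[OF S], of ?v k] by simp
  then have "cinner ?v ?v = cinner 0 ?v"
    by (intro closure_cinner_eq[OF v]) auto
  then show "X (S h) = X' (S h)"
    by (simp add: cinner_self)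
qed

lemma op_le_on_closure:
  assumes "bounded_linear P" "bounded_linear Q" and "op_le_on D P Q"
  shows "op_le_on (closure D) P Q"
proof -
  let ?A = "(\<lambda>h. cinner h (Q h - P h)) -` \<real>\<^sub>\<ge>\<^sub>0"
  have "continuous_on UNIV (\<lambda>h. cinner h (Q h - P h))"
    using assms by (intro cinner.continuous_on continuous_intros linear_continuous_on)
  then have "closed ?A"
    by (rule closed_vimage[OF closed_nonneg_Reals_complex])
  then have "closure D \<subseteq> ?A"
    using assms(3) by (intro closure_minimal) (auto simp: op_le_on_def)
  then show ?thesis
    by (auto simp: op_le_on_def)
qed

section \<open>Operator-valued measures\<close>

lemma povm_positive: "povm m E \<Longrightarrow> A \<in> sets (Omega m) \<Longrightarrow> positive_op (E A)"
  by (simp add: povm_def)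

lemma povm_csigma_additive: "povm m E \<Longrightarrow> csigma_additive m (\<lambda>A. cinner h (E A k))"
  by (simp add: povm_def csigma_additive_def)

lemma povm_split:
  assumes "povm m E"
  shows "E (cylinder m w) h = (\<Sum>j<m. E (cylinder m (w @ [j])) h)"
  by (rule cinner_eqI)
    (simp only: cinner.sum_right csigma_additive_cylinder[OF povm_csigma_additive[OF assms], symmetric])

lemma povm_eqI:
  assumes F: "povm m F" "povm m F'" and eq: "\<And>w. w \<in> words m \<Longrightarrow> F (cylinder m w) = F' (cylinder m w)"
    and A: "A \<in> sets (Omega m)"
  shows "F A = F' A"
proof (rule ext, rule cinner_eqI)
  fix k h
  show "cinner h (F A k) = cinner h (F' A k)"
    by (rule csigma_additive_eq[OF povm_csigma_additive[OF F(1)] povm_csigma_additive[OF F(2)] _ A])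
      (simp add: eq)
qed

lemma povm_scaled_measure:
  assumes E: "povm m E" and c: "c \<ge> 0"
  obtains M where "finite_measure M" "sets M = sets (Omega m)"
    "\<And>A. A \<in> sets (Omega m) \<Longrightarrow> measure M A = c * Re (cinner h (E A h))"
proof (rule finite_measure_of_csigma_additive[of m "\<lambda>A. complex_of_real c * cinner h (E A h)"
      "\<lambda>A. c * Re (cinner h (E A h))"])
  show "csigma_additive m (\<lambda>A. complex_of_real c * cinner h (E A h))"
    by (intro csigma_additive_mult povm_csigma_additive E)
  show "complex_of_real c * cinner h (E A h) = complex_of_real (c * Re (cinner h (E A h)))
      \<and> 0 \<le> c * Re (cinner h (E A h))" if "A \<in> sets (Omega m)" for A
    using povm_positive[OF E that] c by (auto simp: positive_op_iff intro!: complex_eqI)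
qed (use that in blast)

lemma polarization:
  assumes T: "bounded_clinear T"
  shows "cinner h (T k) = (1/4) * (cinner (h + k) (T (h + k)) - cinner (h - k) (T (h - k))
    - \<i> * cinner (h + \<i> *\<^sub>C k) (T (h + \<i> *\<^sub>C k)) + \<i> * cinner (h - \<i> *\<^sub>C k) (T (h - \<i> *\<^sub>C k)))"
proof -
  have lin: "linear T"
    using T by (simp add: bounded_clinear_def bounded_linear.linear)
  show ?thesis
    by (simp add: linear_add[OF lin] linear_diff[OF lin] bounded_clinear_scaleC[OF T] cinner_simps
        algebra_simps)
qed

text \<open>The scalar measures of the extension, one for every vector, are glued by polarization. The
  sesquilinearity of the resulting form is inherited from the cylinders.\<close>

lemma povm_extension:
  fixes E :: "(nat \<Rightarrow> nat) set \<Rightarrow> 'a::complex_hilbert \<Rightarrow> 'a" and G :: "nat list \<Rightarrow> 'a \<Rightarrow> 'a"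
  assumes E: "povm m E" and m: "m > 0" and ab: "0 < a" "a \<le> b"
    and G: "\<And>w. w \<in> words m \<Longrightarrow> bounded_clinear (G w)"
    and Gsplit: "\<And>w h. w \<in> words m \<Longrightarrow> G w h = (\<Sum>j<m. G (w @ [j]) h)"
    and Gid: "G [] = id"
    and Gle: "\<And>w. w \<in> words m \<Longrightarrow> op_le (\<lambda>h. a *\<^sub>R E (cylinder m w) h) (G w)"
    and Gge: "\<And>w. w \<in> words m \<Longrightarrow> op_le (G w) (\<lambda>h. b *\<^sub>R E (cylinder m w) h)"
  obtains F where "F \<in> comparable_povm_set m E" "\<And>w. w \<in> words m \<Longrightarrow> F (cylinder m w) = G w"
proof -
  have posE: "Im (cinner h (E A h)) = 0" "0 \<le> Re (cinner h (E A h))" if "A \<in> sets (Omega m)" for A h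
    using povm_positive[OF E that] by (auto simp: positive_op_iff)
  have Gim: "Im (cinner h (G w h)) = 0"
    and Gl: "a * Re (cinner h (E (cylinder m w) h)) \<le> Re (cinner h (G w h))"
    and Gg: "Re (cinner h (G w h)) \<le> b * Re (cinner h (E (cylinder m w) h))"
    if w: "w \<in> words m" for w h
    using Gle[OF w] Gge[OF w] posE[OF cylinder_sets] by (auto simp: op_le_on_iff cinner_scaleR_right)
  have "\<exists>M. finite_measure M \<and> sets M = sets (Omega m) \<and>
      (\<forall>w\<in>words m. measure M (cylinder m w) = Re (cinner h (G w h)))" for h
  proof -
    obtain e where e: "finite_measure e" "sets e = sets (Omega m)"
      and em: "\<And>A. A \<in> sets (Omega m) \<Longrightarrow> measure e A = b * Re (cinner h (E A h))"
      using povm_scaled_measure[OF E, of b h] ab by auto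
    show ?thesis
    proof (rule dominated_cylinder_extension[OF m e, of "\<lambda>w. Re (cinner h (G w h))"])
      fix w assume w: "w \<in> words m"
      show "Re (cinner h (G w h)) = (\<Sum>j<m. Re (cinner h (G (w @ [j]) h)))"
        by (subst Gsplit[OF w]) (simp add: cinner.sum_right)
      have "0 \<le> a * Re (cinner h (E (cylinder m w) h))"
        using ab posE[OF cylinder_sets] by simp
      then show "0 \<le> Re (cinner h (G w h))"
        using Gl[OF w, of h] by linarith
      show "Re (cinner h (G w h)) \<le> measure e (cylinder m w)"
        using Gg[OF w, of h] by (simp add: em cylinder_sets)
    qed blast
  qed
  then obtain M where Mfin: "\<And>h. finite_measure (M h)" and Msets: "\<And>h. sets (M h) = sets (Omega m)"
    and Mcyl: "\<And>h w. w \<in> words m \<Longrightarrow> measure (M h) (cylinder m w) = Re (cinner h (G w h))"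
    by metis
  have Mcyl': "complex_of_real (measure (M h) (cylinder m w)) = cinner h (G w h)"
    if "w \<in> words m" for h w
    using that by (intro complex_eqI) (simp_all add: Mcyl Gim)
  define s where "s A h k = (1/4) * (complex_of_real (measure (M (h + k)) A)
    - complex_of_real (measure (M (h - k)) A) - \<i> * complex_of_real (measure (M (h + \<i> *\<^sub>C k)) A)
    + \<i> * complex_of_real (measure (M (h - \<i> *\<^sub>C k)) A))" for A h k
  note Madd = csigma_additive_measure[OF Mfin Msets]
  have sadd: "csigma_additive m (\<lambda>A. s A h k)" for h k
    unfolding s_def
    by (intro csigma_additive_mult csigma_additive_add csigma_additive_diff Madd)
  have scyl: "s (cylinder m w) h k = cinner h (G w k)" if w: "w \<in> words m" for w h k
    unfolding s_def Mcyl'[OF w] by (rule polarization[OF G[OF w], symmetric])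
  have sdiag: "s A h h = complex_of_real (measure (M h) A)" if A: "A \<in> sets (Omega m)" for A h
    by (rule csigma_additive_eq[OF sadd Madd _ A]) (simp only: scyl Mcyl')
  have Mle: "measure (M h) A \<le> (norm h)\<^sup>2" for A h
  proof -
    have "measure (M h) A \<le> measure (M h) (space (M h))"
      by (rule finite_measure.bounded_measure[OF Mfin])
    also have "space (M h) = cylinder m []"
      using sets_eq_imp_space_eq[OF Msets] by (simp add: cylinder_Nil)
    also have "measure (M h) (cylinder m []) = (norm h)\<^sup>2"
      by (simp add: Mcyl Gid Re_cinner_self)
    finally show ?thesis .
  qed
  have op: "\<exists>T. bounded_clinear T \<and> (\<forall>h k. cinner h (T k) = s A h k)" if A: "A \<in> sets (Omega m)" for A
  proof -
    have addl: "s A (x + y) z = s A x z + s A y z" for x y z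
      by (rule csigma_additive_eq[OF sadd csigma_additive_add[OF sadd sadd] _ A])
        (simp add: scyl cinner_add_left)
    have addr: "s A x (y + z) = s A x y + s A x z" for x y z
      by (rule csigma_additive_eq[OF sadd csigma_additive_add[OF sadd sadd] _ A])
        (simp add: scyl cinner_add_right bounded_clinear_add[OF G])
    have scl: "s A (c *\<^sub>C x) y = cnj c * s A x y" for c x y
      by (rule csigma_additive_eq[OF sadd csigma_additive_mult[OF sadd] _ A])
        (simp add: scyl cinner_scaleC_left)
    have scr: "s A x (c *\<^sub>C y) = c * s A x y" for c x y
      by (rule csigma_additive_eq[OF sadd csigma_additive_mult[OF sadd] _ A])
        (simp add: scyl cinner_scaleC_right bounded_clinear_scaleC[OF G])
    \<comment> \<open>The form is bounded on unit vectors, and everywhere by homogeneity.\<close>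
    have unit: "norm (s A x y) \<le> 4" if xy: "norm x = 1" "norm y = 1" for x y
    proof -
      have two: "measure (M z) A \<le> 4" if z: "norm z \<le> 2" for z
      proof -
        have "(norm z)\<^sup>2 \<le> 2\<^sup>2"
          using z by (intro power_mono) auto
        then show ?thesis
          using Mle[of z A] by simp
      qed
      have n: "norm (x + y) \<le> 2" "norm (x - y) \<le> 2" "norm (x + \<i> *\<^sub>C y) \<le> 2" "norm (x - \<i> *\<^sub>C y) \<le> 2"
        using norm_triangle_ineq[of x y] norm_triangle_ineq4[of x y]
          norm_triangle_ineq[of x "\<i> *\<^sub>C y"] norm_triangle_ineq4[of x "\<i> *\<^sub>C y"] xy
        by (simp_all add: norm_scaleC)
      have tri: "norm (p - q - r + t) \<le> norm p + norm q + norm r + norm t" for p q r t :: complex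
        using norm_triangle_ineq[of "p - q - r" t] norm_triangle_ineq4[of "p - q" r]
          norm_triangle_ineq4[of p q] by linarith
      show ?thesis
        unfolding s_def norm_mult
        using tri[of "complex_of_real (measure (M (x + y)) A)" "complex_of_real (measure (M (x - y)) A)"
            "\<i> * complex_of_real (measure (M (x + \<i> *\<^sub>C y)) A)" "\<i> * complex_of_real (measure (M (x - \<i> *\<^sub>C y)) A)"]
          two[OF n(1)] two[OF n(2)] two[OF n(3)] two[OF n(4)]
        by (simp add: norm_mult)
    qed
    have bd: "norm (s A x y) \<le> 4 * norm x * norm y" for x y
    proof (cases "x = 0 \<or> y = 0")
      case True
      then have "s A x y = 0"
        using scl[of 0 x y] scr[of x 0 y] by auto
      then show ?thesis
        by simp
    next
      case False
      define u v where "u = complex_of_real (1 / norm x) *\<^sub>C x" and "v = complex_of_real (1 / norm y) *\<^sub>C y"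
      have "norm u = 1" "norm v = 1"
        using False by (simp_all add: u_def v_def norm_scaleC norm_divide)
      then have "norm (s A u v) \<le> 4"
        by (rule unit)
      moreover have "norm (s A x y) = norm x * norm y * norm (s A u v)"
      proof -
        have xy: "complex_of_real (norm x) *\<^sub>C u = x" "complex_of_real (norm y) *\<^sub>C v = y"
          using False by (simp_all add: u_def v_def scaleC_scaleC flip: of_real_mult)
        have "s A (complex_of_real (norm x) *\<^sub>C u) (complex_of_real (norm y) *\<^sub>C v)
            = complex_of_real (norm y) * (complex_of_real (norm x) * s A u v)"
          by (simp only: scl scr complex_cnj_complex_of_real)
        then show ?thesis
          unfolding xy by (simp add: norm_mult)
      qed
      ultimately show ?thesis
        using mult_left_mono[of "norm (s A u v)" 4 "norm x * norm y"] by (simp add: mult_ac)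
    qed
    show ?thesis
      by (rule form_operator[of "s A" 4, OF addl addr scl scr bd]) auto
  qed
  define F where "F = restrict (\<lambda>A. SOME T. bounded_clinear T \<and> (\<forall>h k. cinner h (T k) = s A h k)) (sets (Omega m))"
  have Fbc: "bounded_clinear (F A)" and F: "cinner h (F A k) = s A h k" if A: "A \<in> sets (Omega m)" for A h k
    using someI_ex[OF op[OF A]] A by (auto simp: F_def)
  have Fcyl: "F (cylinder m w) = G w" if w: "w \<in> words m" for w
    by (rule ext, rule cinner_eqI) (simp add: F cylinder_sets scyl[OF w])
  have "povm m F"
    unfolding povm_def
  proof (intro conjI ballI allI impI)
    show "positive_op (F A)" if "A \<in> sets (Omega m)" for A
      using that by (simp add: positive_op_iff Fbc F sdiag)
    show "(\<lambda>n. cinner h (F (A n) k)) sums cinner h (F (\<Union>n. A n) k)"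
      if A: "range A \<subseteq> sets (Omega m)" "disjoint_family A" for A :: "nat \<Rightarrow> _" and h k
    proof -
      have "A n \<in> sets (Omega m)" for n
        using A(1) by auto
      moreover have "(\<Union>n. A n) \<in> sets (Omega m)"
        using A(1) by auto
      moreover have "(\<lambda>n. s (A n) h k) sums s (\<Union>n. A n) h k"
        using sadd A by (simp add: csigma_additive_def)
      ultimately show ?thesis
        by (simp add: F)
    qed
    show "F (space (Omega m)) = id"
      using Fcyl[of "[]"] by (simp add: cylinder_Nil Gid)
  qed
  moreover have "comparable_povm m E F"
    unfolding comparable_povm_def
  proof (rule exI[of _ a], rule exI[of _ b], intro conjI ballI ab)
    fix A assume A: "A \<in> sets (Omega m)"
    have le: "a * Re (cinner h (E A h)) \<le> measure (M h) A" for h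
    proof -
      obtain e where e: "finite_measure e" "sets e = sets (Omega m)"
        and em: "\<And>A. A \<in> sets (Omega m) \<Longrightarrow> measure e A = a * Re (cinner h (E A h))"
        using povm_scaled_measure[OF E, of a h] ab by auto
      have "measure e A \<le> measure (M h) A"
        by (rule measure_le_of_cylinders[OF m e Mfin Msets _ A]) (simp add: em cylinder_sets Mcyl Gl)
      then show ?thesis
        by (simp add: em A)
    qed
    have ge: "measure (M h) A \<le> b * Re (cinner h (E A h))" for h
    proof -
      obtain e where e: "finite_measure e" "sets e = sets (Omega m)"
        and em: "\<And>A. A \<in> sets (Omega m) \<Longrightarrow> measure e A = b * Re (cinner h (E A h))"
        using povm_scaled_measure[OF E, of b h] ab by auto
      have "measure (M h) A \<le> measure e A"
        by (rule measure_le_of_cylinders[OF m Mfin Msets e _ A]) (simp add: em cylinder_sets Mcyl Gg)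
      then show ?thesis
        by (simp add: em A)
    qed
    show "op_le (\<lambda>h. a *\<^sub>R E A h) (F A)" "op_le (F A) (\<lambda>h. b *\<^sub>R E A h)"
      using le ge posE[OF A] by (simp_all add: op_le_on_iff F[OF A] sdiag[OF A] cinner_scaleR_right)
  qed
  moreover have "F \<in> extensional (sets (Omega m))"
    by (simp add: F_def)
  ultimately show ?thesis
    using Fcyl by (intro that) (auto simp: comparable_povm_set_def)
qed

section \<open>Edge contractions and range martingales\<close>

text \<open>The right-hand side of the martingale relation.\<close>

definition edge_average ::
  "nat \<Rightarrow> ((nat \<Rightarrow> nat) set \<Rightarrow> 'a::complex_inner \<Rightarrow> 'a) \<Rightarrow> nat list \<Rightarrow> (nat list \<Rightarrow> 'a \<Rightarrow> 'a) \<Rightarrow> 'a \<Rightarrow> 'a" where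
  "edge_average m E w X = (\<lambda>h. \<Sum>j<m. cadjoint (edge_contraction m E w j)
     (X (w @ [j]) (edge_contraction m E w j h)))"

text \<open>The cylinder formula that links a range martingale with a POVM.\<close>

definition corresponds ::
  "nat \<Rightarrow> ((nat \<Rightarrow> nat) set \<Rightarrow> 'a::complex_inner \<Rightarrow> 'a) \<Rightarrow> (nat list \<Rightarrow> 'a \<Rightarrow> 'a) \<Rightarrow>
    ((nat \<Rightarrow> nat) set \<Rightarrow> 'a \<Rightarrow> 'a) \<Rightarrow> bool" where
  "corresponds m E X F \<longleftrightarrow>
     (\<forall>w\<in>words m. F (cylinder m w) = sqrtE m E w \<circ> X w \<circ> sqrtE m E w)"

context
  fixes m :: nat and E :: "(nat \<Rightarrow> nat) set \<Rightarrow> 'a::complex_hilbert \<Rightarrow> 'a"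
  assumes E: "povm m E"
begin

lemma sqrtE_positive: "positive_op (sqrtE m E w)"
  unfolding sqrtE_def by (intro op_sqrt_positive povm_positive[OF E] cylinder_sets)

lemma sqrtE_sqrtE: "sqrtE m E w (sqrtE m E w h) = E (cylinder m w) h"
  unfolding sqrtE_def by (intro op_sqrt_positive povm_positive[OF E] cylinder_sets)

lemma norm_sqrtE_sq: "(norm (sqrtE m E w h))\<^sup>2 = Re (cinner h (E (cylinder m w) h))"
  unfolding sqrtE_def by (intro norm_op_sqrt_sq povm_positive[OF E] cylinder_sets)

lemma cinner_sqrtE: "cinner (sqrtE m E w x) y = cinner x (sqrtE m E w y)"
  by (rule selfadjointD[OF positive_op_selfadjoint[OF sqrtE_positive]])

lemma sqrtE_Nil: "sqrtE m E [] = id"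
  unfolding sqrtE_def
proof (rule op_sqrt_eqI)
  show "positive_op (id :: 'a \<Rightarrow> 'a)"
    by (auto simp: positive_op_iff cinner_self bounded_clinear_def id_def bounded_linear_ident)
  show "id (id x) = E (cylinder m []) x" for x
    using E by (simp add: povm_def cylinder_Nil)
qed

lemma csubspace_range_space: "csubspace (range_space m E w)" and closed_range_space: "closed (range_space m E w)"
  unfolding range_space_def
  by (auto intro: csubspace_closure csubspace_range positive_op_bc sqrtE_positive)

lemma norm_sqrtE_snoc_le:
  assumes "j < m"
  shows "norm (sqrtE m E (w @ [j]) h) \<le> norm (sqrtE m E w h)"
proof (rule power2_le_imp_le)
  have pos: "0 \<le> Re (cinner h (E (cylinder m (w @ [i])) h))" for i
    using povm_positive[OF E cylinder_sets] by (simp add: positive_op_iff)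
  have "Re (cinner h (E (cylinder m (w @ [j])) h)) \<le> (\<Sum>i<m. Re (cinner h (E (cylinder m (w @ [i])) h)))"
    using assms pos by (intro member_le_sum) auto
  also have "\<dots> = Re (cinner h (E (cylinder m w) h))"
    by (simp add: povm_split[OF E, of w] cinner.sum_right)
  finally show "(norm (sqrtE m E (w @ [j]) h))\<^sup>2 \<le> (norm (sqrtE m E w h))\<^sup>2"
    by (simp only: norm_sqrtE_sq)
qed simp

text \<open>The edge contraction exists by Douglas factorisation with constant 1, and is unique because the
  range of the root is dense in its domain.\<close>

lemma
  assumes j: "j < m"
  shows edge_contraction_bops: "edge_contraction m E w j \<in> bops (range_space m E w) (range_space m E (w @ [j]))"
    and edge_contraction_sqrtE: "edge_contraction m E w j (sqrtE m E w h) = sqrtE m E (w @ [j]) h"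
proof -
  let ?P = "\<lambda>C. C \<in> bops (range_space m E w) (range_space m E (w @ [j])) \<and> onorm C \<le> 1 \<and>
        (\<forall>h. C (sqrtE m E w h) = sqrtE m E (w @ [j]) h)"
  obtain D where D: "D \<in> bops (range_space m E w) (range_space m E (w @ [j]))"
    "\<And>h. D (sqrtE m E w h) = sqrtE m E (w @ [j]) h" "\<And>x. norm (D x) \<le> 1 * norm x"
    unfolding range_space_def
    using douglas[OF positive_op_bc[OF sqrtE_positive] positive_op_bc[OF sqrtE_positive], of 1 "w @ [j]" w]
      norm_sqrtE_snoc_le[OF j] by auto
  have "onorm D \<le> 1"
    by (rule onorm_bound) (use D(3) in auto)
  then have "?P D"
    using D by blast
  moreover have "C = D" if "?P C" for C
    using that D unfolding range_space_def
    by (intro bops_eqI_range[OF positive_op_bc[OF sqrtE_positive]]) auto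
  ultimately have "?P (edge_contraction m E w j)"
    unfolding edge_contraction_def by (rule theI)
  then show "edge_contraction m E w j \<in> bops (range_space m E w) (range_space m E (w @ [j]))"
    "edge_contraction m E w j (sqrtE m E w h) = sqrtE m E (w @ [j]) h"
    by auto
qed

lemma edge_contraction_bc: "j < m \<Longrightarrow> bounded_clinear (edge_contraction m E w j)"
  using edge_contraction_bops by (auto simp: bops_def)

lemma sqrtE_cadjoint_edge:
  assumes j: "j < m"
  shows "sqrtE m E w (cadjoint (edge_contraction m E w j) x) = sqrtE m E (w @ [j]) x"
  by (rule cinner_eqI_left)
    (simp add: cinner_sqrtE cadjoint_exists(2)[OF edge_contraction_bc[OF j]] edge_contraction_sqrtE[OF j])

lemma sqrtE_edge_average:
  "sqrtE m E w (edge_average m E w X (sqrtE m E w h))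
    = (\<Sum>j<m. sqrtE m E (w @ [j]) (X (w @ [j]) (sqrtE m E (w @ [j]) h)))"
proof -
  have "linear (sqrtE m E w)"
    using positive_op_bc[OF sqrtE_positive] by (simp add: bounded_clinear_def bounded_linear.linear)
  then show ?thesis
    by (simp add: edge_average_def linear_sum sqrtE_cadjoint_edge edge_contraction_sqrtE)
qed

lemma edge_average_bops:
  assumes X: "\<And>j. j < m \<Longrightarrow> X (w @ [j]) \<in> bops (range_space m E (w @ [j])) (range_space m E (w @ [j]))"
  shows "edge_average m E w X \<in> bops (range_space m E w) (range_space m E w)"
proof -
  let ?C = "edge_contraction m E w"
  have Xbc: "bounded_clinear (X (w @ [j]))" if "j < m" for j
    using X[OF that] by (simp add: bops_def)
  have abc: "bounded_clinear (cadjoint (?C j))" and ar: "cadjoint (?C j) x \<in> range_space m E w"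
    if "j < m" for j x
    using cadjoint_bops[OF edge_contraction_bops[OF that] csubspace_range_space closed_range_space]
    by (auto simp: bops_def)
  have zero: "T 0 = 0" if "bounded_clinear T" for T :: "'a \<Rightarrow> 'a"
    using that by (simp add: bounded_clinear_def bounded_linear.linear linear_0)
  have "bounded_clinear (edge_average m E w X)"
    unfolding edge_average_def
    by (intro bounded_clinear_sum bounded_clinear_compose[OF abc] bounded_clinear_compose[OF Xbc]
        edge_contraction_bc) auto
  moreover have "edge_average m E w X x \<in> range_space m E w" for x
    unfolding edge_average_def using csubspace_range_space ar
    by (intro subspace_sum) (auto simp: csubspace_def)
  moreover have "edge_average m E w X x = 0" if "x \<in> orth_compl (range_space m E w)" for x
    unfolding edge_average_def
  proof (intro sum.neutral ballI)
    fix j assume "j \<in> {..<m}"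
    then have j: "j < m" by simp
    then have "?C j x = 0"
      using edge_contraction_bops[OF j, of w] that by (auto simp: bops_def)
    then show "cadjoint (?C j) (X (w @ [j]) (?C j x)) = 0"
      by (simp add: zero[OF Xbc[OF j]] zero[OF abc[OF j]])
  qed
  ultimately show ?thesis
    by (auto simp: bops_def)
qed

lemma bounded_range_martingale_iff:
  "bounded_range_martingale m E X \<longleftrightarrow>
     (\<forall>w\<in>words m. X w \<in> bops (range_space m E w) (range_space m E w) \<and> selfadjoint (X w)) \<and>
     bdd_above ((\<lambda>w. onorm (X w)) ` words m) \<and> (\<forall>w\<in>words m. X w = edge_average m E w X)"
  by (simp add: bounded_range_martingale_def edge_average_def)

section \<open>The correspondence\<close>

lemma martingale_set_bounded: "X \<in> martingale_set m E \<Longrightarrow> bounded_range_martingale m E X"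
  by (simp add: martingale_set_def strictly_positive_range_martingale_def positive_range_martingale_def)

lemma povm_of_martingale:
  assumes m: "m > 0" and X: "X \<in> martingale_set m E"
  shows "\<exists>F\<in>comparable_povm_set m E. corresponds m E X F"
proof -
  have Xid: "X [] = id"
    using X by (simp add: martingale_set_def normalized_martingale_def)
  have Xb: "X w \<in> bops (range_space m E w) (range_space m E w)" and Xe: "X w = edge_average m E w X"
    if "w \<in> words m" for w
    using martingale_set_bounded[OF X] that unfolding bounded_range_martingale_iff by blast+
  obtain a b :: real where ab: "0 < a" "a \<le> b"
    and Xl: "\<And>w. w \<in> words m \<Longrightarrow> op_le_on (range_space m E w) (\<lambda>h. a *\<^sub>R h) (X w)"
    and Xg: "\<And>w. w \<in> words m \<Longrightarrow> op_le_on (range_space m E w) (X w) (\<lambda>h. b *\<^sub>R h)"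
    using X by (auto simp: martingale_set_def strictly_positive_range_martingale_def)
  define G where "G w = sqrtE m E w \<circ> X w \<circ> sqrtE m E w" for w
  have form: "cinner h (G w h) = cinner (sqrtE m E w h) (X w (sqrtE m E w h))" for w h
    by (simp add: G_def cinner_sqrtE)
  have inr: "sqrtE m E w h \<in> range_space m E w" for w h
    unfolding range_space_def by (rule subsetD[OF closure_subset]) simp
  have formE: "cinner h (r *\<^sub>R E (cylinder m w) h) = cinner (sqrtE m E w h) (r *\<^sub>R sqrtE m E w h)" for w h r
    by (simp add: cinner_scaleR_right cinner_sqrtE sqrtE_sqrtE)
  obtain F where "F \<in> comparable_povm_set m E" "\<And>w. w \<in> words m \<Longrightarrow> F (cylinder m w) = G w"
  proof (rule povm_extension[OF E m ab, of G])
    fix w assume w: "w \<in> words m"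
    have S: "bounded_clinear (sqrtE m E w)"
      by (rule positive_op_bc[OF sqrtE_positive])
    have "bounded_clinear (X w)"
      using Xb[OF w] by (simp add: bops_def)
    from bounded_clinear_compose[OF S bounded_clinear_compose[OF this S]]
    show "bounded_clinear (G w)"
      by (simp add: G_def comp_def)
    show "G w h = (\<Sum>j<m. G (w @ [j]) h)" for h
      unfolding G_def comp_def by (subst Xe[OF w]) (rule sqrtE_edge_average)
    show "op_le (\<lambda>h. a *\<^sub>R E (cylinder m w) h) (G w)"
      using Xl[OF w] inr by (auto simp: op_le_on_iff form formE)
    show "op_le (G w) (\<lambda>h. b *\<^sub>R E (cylinder m w) h)"
      using Xg[OF w] inr by (auto simp: op_le_on_iff form formE)
  next
    show "G [] = id"
      by (simp add: G_def sqrtE_Nil Xid)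
  qed blast
  then show ?thesis
    by (auto simp: corresponds_def G_def)
qed

lemma martingale_of_povm:
  assumes F: "F \<in> comparable_povm_set m E"
  shows "\<exists>X\<in>martingale_set m E. corresponds m E X F"
proof -
  have povmF: "povm m F"
    using F by (simp add: comparable_povm_set_def)
  obtain a b :: real where ab: "0 < a" "a \<le> b"
    and Fl: "\<And>A. A \<in> sets (Omega m) \<Longrightarrow> op_le (\<lambda>h. a *\<^sub>R E A h) (F A)"
    and Fg: "\<And>A. A \<in> sets (Omega m) \<Longrightarrow> op_le (F A) (\<lambda>h. b *\<^sub>R E A h)"
    using F by (auto simp: comparable_povm_set_def comparable_povm_def)
  have "\<exists>X. X \<in> bops (range_space m E w) (range_space m E w) \<and> selfadjoint X \<and>
      (\<forall>x. norm (X x) \<le> b * norm x) \<and> (\<forall>h. sqrtE m E w (X (sqrtE m E w h)) = F (cylinder m w) h)" for w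
  proof (rule sandwich_exists[OF sqrtE_positive[of w] povm_positive[OF povmF cylinder_sets[of m w]], where b=b])
    show "b \<ge> 0"
      using ab by simp
    show "Re (cinner h (F (cylinder m w) h)) \<le> b * (norm (sqrtE m E w h))\<^sup>2" for h
      using Fg[OF cylinder_sets, of w] by (simp add: op_le_on_iff cinner_scaleR_right norm_sqrtE_sq)
  qed (auto simp: range_space_def)
  then obtain Y where Yb: "\<And>w. Y w \<in> bops (range_space m E w) (range_space m E w)"
    and Ys: "\<And>w. selfadjoint (Y w)" and Yn: "\<And>w x. norm (Y w x) \<le> b * norm x"
    and YF: "\<And>w h. sqrtE m E w (Y w (sqrtE m E w h)) = F (cylinder m w) h"
    by metis
  define X where "X = restrict Y (words m)"
  have XY: "X w = Y w" if "w \<in> words m" for w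
    using that by (simp add: X_def)
  have form: "cinner (sqrtE m E w h) (Y w (sqrtE m E w h)) = cinner h (F (cylinder m w) h)" for w h
    by (simp add: cinner_sqrtE YF)
  have formE: "cinner (sqrtE m E w h) (r *\<^sub>R sqrtE m E w h) = cinner h (r *\<^sub>R E (cylinder m w) h)" for w h r
    by (simp add: cinner_scaleR_right cinner_sqrtE sqrtE_sqrtE)
  have bl: "bounded_linear (Y w)" "bounded_linear (\<lambda>h::'a. r *\<^sub>R h)" for w r
    using Yb[of w] by (auto simp: bops_def bounded_clinear_def bounded_linear_scaleR_right)
  have Yl: "op_le_on (range_space m E w) (\<lambda>h. a *\<^sub>R h) (Y w)" for w
    unfolding range_space_def
    by (rule op_le_on_closure[OF bl(2) bl(1)])
      (use Fl[OF cylinder_sets, of w] in \<open>simp add: op_le_on_iff form formE\<close>)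
  have Yg: "op_le_on (range_space m E w) (Y w) (\<lambda>h. b *\<^sub>R h)" for w
    unfolding range_space_def
    by (rule op_le_on_closure[OF bl(1) bl(2)])
      (use Fg[OF cylinder_sets, of w] in \<open>simp add: op_le_on_iff form formE\<close>)
  have Y0: "op_le_on (range_space m E w) (\<lambda>h. 0) (Y w)" for w
    unfolding op_le_on_iff
  proof
    fix h assume h: "h \<in> range_space m E w"
    have "0 \<le> a * (norm h)\<^sup>2"
      using ab by simp
    with Yl[of w] h show "Im (cinner h (Y w h)) = Im (cinner h 0) \<and> Re (cinner h 0) \<le> Re (cinner h (Y w h))"
      by (auto simp: op_le_on_iff cinner_scaleR_right cinner_self)
  qed
  have split: "Y w = edge_average m E w X" if w: "w \<in> words m" for w
  proof (rule sandwich_inj[OF sqrtE_positive])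
    have wj: "w @ [j] \<in> words m" if "j < m" for j
      using w that by simp
    show "Y w \<in> bops (closure (range (sqrtE m E w))) (closure (range (sqrtE m E w)))"
      using Yb by (simp add: range_space_def)
    show "edge_average m E w X \<in> bops (closure (range (sqrtE m E w))) (closure (range (sqrtE m E w)))"
      unfolding range_space_def[symmetric] by (rule edge_average_bops) (use Yb wj XY in simp)
    show "sqrtE m E w (Y w (sqrtE m E w h)) = sqrtE m E w (edge_average m E w X (sqrtE m E w h))" for h
      unfolding sqrtE_edge_average YF povm_split[OF povmF, of w]
      by (intro sum.cong refl) (use wj XY YF in simp)
  qed
  have "bounded_range_martingale m E X"
    unfolding bounded_range_martingale_iff
  proof (intro conjI ballI)
    show "bdd_above ((\<lambda>w. onorm (X w)) ` words m)"
    proof (rule bdd_aboveI2[of _ _ b])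
      show "onorm (X w) \<le> b" if "w \<in> words m" for w
        using ab Yn by (simp add: XY[OF that] onorm_bound)
    qed
    show "X w \<in> bops (range_space m E w) (range_space m E w)" "selfadjoint (X w)"
      "X w = edge_average m E w X" if "w \<in> words m" for w
      unfolding XY[OF that] by (fact Yb Ys split[OF that])+
  qed
  moreover have "X [] = id"
  proof
    fix h
    show "X [] h = id h"
      using YF[of "[]" h] povmF by (simp add: XY sqrtE_Nil cylinder_Nil povm_def)
  qed
  moreover have "\<exists>a b::real. 0 < a \<and> a \<le> b \<and>
      (\<forall>w\<in>words m. op_le_on (range_space m E w) (\<lambda>h. a *\<^sub>R h) (X w) \<and>
         op_le_on (range_space m E w) (X w) (\<lambda>h. b *\<^sub>R h))"
    by (rule exI[of _ a], rule exI[of _ b]) (simp add: ab Yl Yg XY)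
  moreover have "X \<in> extensional (words m)"
    by (simp add: X_def)
  ultimately have "X \<in> martingale_set m E"
    unfolding martingale_set_def strictly_positive_range_martingale_def positive_range_martingale_def
      normalized_martingale_def
    using Y0 XY by simp
  moreover have "corresponds m E X F"
    unfolding corresponds_def by (auto simp: fun_eq_iff XY YF)
  ultimately show ?thesis
    by blast
qed

lemma corresponds_unique_povm:
  assumes "F \<in> comparable_povm_set m E" "F' \<in> comparable_povm_set m E"
    and "corresponds m E X F" "corresponds m E X F'"
  shows "F = F'"
proof (rule extensionalityI)
  show "F \<in> extensional (sets (Omega m))" "F' \<in> extensional (sets (Omega m))"
    using assms by (auto simp: comparable_povm_set_def)
  show "F A = F' A" if "A \<in> sets (Omega m)" for A
    by (rule povm_eqI[OF _ _ _ that]) (use assms in \<open>auto simp: comparable_povm_set_def corresponds_def\<close>)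
qed

lemma corresponds_unique_martingale:
  assumes X: "X \<in> martingale_set m E" "X' \<in> martingale_set m E"
    and c: "corresponds m E X F" "corresponds m E X' F"
  shows "X = X'"
proof (rule extensionalityI)
  show "X \<in> extensional (words m)" "X' \<in> extensional (words m)"
    using X by (auto simp: martingale_set_def)
  show "X w = X' w" if w: "w \<in> words m" for w
  proof (rule sandwich_inj[OF sqrtE_positive])
    show "X w \<in> bops (closure (range (sqrtE m E w))) (closure (range (sqrtE m E w)))"
      "X' w \<in> bops (closure (range (sqrtE m E w))) (closure (range (sqrtE m E w)))"
      unfolding range_space_def[symmetric] using martingale_set_bounded[OF X(1)]
        martingale_set_bounded[OF X(2)] w unfolding bounded_range_martingale_def by blast+
    show "sqrtE m E w (X w (sqrtE m E w h)) = sqrtE m E w (X' w (sqrtE m E w h))" for h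
      using c w unfolding corresponds_def by (metis comp_apply)
  qed
qed

end

theorem proposition6p2:
  fixes m :: nat and E :: "(nat \<Rightarrow> nat) set \<Rightarrow> 'a::complex_hilbert \<Rightarrow> 'a"
  assumes "m \<ge> 2" and "povm m E"
  shows "\<exists>\<Phi>. bij_betw \<Phi> (martingale_set m E) (comparable_povm_set m E) \<and>
    (\<forall>X\<in>martingale_set m E. \<forall>w\<in>words m.
       \<Phi> X (cylinder m w) = sqrtE m E w \<circ> X w \<circ> sqrtE m E w)"
proof -
  have m: "m > 0"
    using assms(1) by simp
  define \<Phi> where "\<Phi> X = (SOME F. F \<in> comparable_povm_set m E \<and> corresponds m E X F)" for X
  have \<Phi>: "\<Phi> X \<in> comparable_povm_set m E" "corresponds m E X (\<Phi> X)" if "X \<in> martingale_set m E" for X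
    using someI_ex[of "\<lambda>F. F \<in> comparable_povm_set m E \<and> corresponds m E X F"]
      povm_of_martingale[OF assms(2) m that] by (auto simp: \<Phi>_def)
  have "bij_betw \<Phi> (martingale_set m E) (comparable_povm_set m E)"
    unfolding bij_betw_def
  proof (intro conjI equalityI subsetI)
    show "inj_on \<Phi> (martingale_set m E)"
      by (rule inj_onI) (metis \<Phi>(2) corresponds_unique_martingale[OF assms(2)])
    show "F \<in> comparable_povm_set m E" if "F \<in> \<Phi> ` martingale_set m E" for F
      using that \<Phi>(1) by auto
    fix F assume F: "F \<in> comparable_povm_set m E"
    then obtain X where X: "X \<in> martingale_set m E" "corresponds m E X F"
      using martingale_of_povm[OF assms(2)] by blast
    then have "\<Phi> X = F"
      using corresponds_unique_povm[OF assms(2) \<Phi>(1) F \<Phi>(2)] by blast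
    with X(1) show "F \<in> \<Phi> ` martingale_set m E"
      by blast
  qed
  with \<Phi>(2) show ?thesis
    unfolding corresponds_def by blast
qed

end
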